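(* Let $0<p<\infty$, $d\ge1$, let $\mu$ be a finite positive Borel measure on $\overline{B}_d$, and let $l$ be a positive integer with $pl>1$. For $w\in B_d$ put $k_w(z)=(1-\langle z,w\rangle)^{-d}$ and $K_w=k_w^l/\|k_w^l\|_{H^p}$. The following are equivalent: (i) there is $C>0$ with $\int_{\overline{B}_d}|f|^p\,d\mu\ge C\|f\|^p_{H^p}$ for all $f\in C(\overline{B}_d)\cap H^p(B_d)$; (ii) there is $C>0$ with $\int_{\overline{B}_d}|K_w|^p\,d\mu\ge C$ for all $w\in B_d$; (iii) there is $C>0$ with $\mu(Q)\ge C\sigma(Q)$ for all non-isotropic balls $Q\subset\partial B_d$.
   Context: $B_d$ is the open unit ball of $\mathbb{C}^d$, $\sigma$ the normalized surface measure on $\partial B_d$, $\langle z,w\rangle=\sum z_k\overline{w_k}$. $H^p(B_d)$ ($0<p<\infty$) is the space of holomorphic $f$ on $B_d$ with $\|f\|^p_{H^p}=\sup_{0<r<1}\int_{\partial B_d}|f(r\zeta)|^p\,d\sigma(\zeta)<\infty$. A non-isotropic ball is a set $Q(\zeta,\delta)=\{\xi\in\partial B_d:|1-\langle\zeta,\xi\rangle|\le\delta\}$, $\zeta\in\partial B_d$, $\delta>0$. *)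

theory Defs
  imports "HOL-Analysis.Analysis"
begin

definition cinner :: "complex^'n \<Rightarrow> complex^'n \<Rightarrow> complex" where
  "cinner z w = (\<Sum>i\<in>UNIV. z$i * cnj (w$i))"

definition holo_on :: "(complex^'n \<Rightarrow> complex) \<Rightarrow> (complex^'n) set \<Rightarrow> bool" where
  "holo_on f S \<longleftrightarrow> (\<forall>z\<in>S. \<exists>L. (f has_derivative L) (at z) \<and> (\<forall>(c::complex) x. L (c *s x) = c * L x))"

text \<open>Normalized surface measure on the unit sphere: the push-forward of normalized
  Lebesgue measure on the unit ball under radial projection x \<mapsto> x/|x|
  (the normalized cone measure, which coincides with normalized surface measure).\<close>
definition sigma_sphere :: "(complex^'n) measure" where
  "sigma_sphere = distr (uniform_measure lborel (ball 0 1)) borel (\<lambda>x. sgn x)"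

definition Hp_pnorm :: "real \<Rightarrow> (complex^'n \<Rightarrow> complex) \<Rightarrow> ennreal" where
  "Hp_pnorm p f = (SUP r\<in>{0<..<1::real}. \<integral>\<^sup>+ \<zeta>. ennreal (norm (f (r *\<^sub>R \<zeta>)) powr p) \<partial>sigma_sphere)"

definition in_Hp :: "real \<Rightarrow> (complex^'n \<Rightarrow> complex) \<Rightarrow> bool" where
  "in_Hp p f \<longleftrightarrow> holo_on f (ball 0 1) \<and> Hp_pnorm p f < \<infinity>"

definition Hp_norm :: "real \<Rightarrow> (complex^'n \<Rightarrow> complex) \<Rightarrow> real" where
  "Hp_norm p f = enn2real (Hp_pnorm p f) powr (1 / p)"

definition kern :: "complex^'n \<Rightarrow> complex^'n \<Rightarrow> complex" where
  "kern w z = inverse ((1 - cinner z w) ^ CARD('n))"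

definition Kn :: "real \<Rightarrow> nat \<Rightarrow> complex^'n \<Rightarrow> complex^'n \<Rightarrow> complex" where
  "Kn p l w z = kern w z ^ l / complex_of_real (Hp_norm p (\<lambda>z. kern w z ^ l))"

definition nball :: "complex^'n \<Rightarrow> real \<Rightarrow> (complex^'n) set" where
  "nball \<zeta> \<delta> = {\<xi> \<in> sphere 0 1. cmod (1 - cinner \<zeta> \<xi>) \<le> \<delta>}"

end

theory Submission
  imports Defs "HOL-Complex_Analysis.Complex_Analysis" "HOL-Computational_Algebra.Fundamental_Theorem_Algebra"
    "HOL-Real_Asymp.Real_Asymp"
begin

text \<open>
  \<open>(i) \<Longrightarrow> (ii)\<close>: test with \<open>K\<^sub>w\<close>.

  \<open>(ii) \<Longrightarrow> (iii)\<close>: integrate (ii) for \<open>w = r\<zeta>\<close> over \<open>\<zeta> \<in> Q\<close> and exchange the integrals. By unitary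
  invariance \<open>\<integral> |K\<^bsub>r\<zeta>\<^esub>(z)|\<^sup>p d\<sigma>(\<zeta>) \<le> 1\<close> for every \<open>z\<close> in the closed ball, because the integral of the
  unnormalised kernel is one of the means whose supremum (or a limit of such means) is the
  normalising factor. Off \<open>Q\<close> the kernels tend to \<open>0\<close> as \<open>r \<rightarrow> 1\<close>, since \<open>pl > 1\<close> and
  \<open>\<sigma>(Q(\<zeta>,\<delta>)) \<ge> c \<delta>\<^sup>d\<close> force the normalising factor to blow up.

  \<open>(iii) \<Longrightarrow> (i)\<close>: integrating \<open>u(\<zeta>) \<mu>(Q(\<zeta>,\<delta>)) \<ge> C u(\<zeta>) \<sigma>(Q(\<zeta>,\<delta>))\<close> against \<open>\<sigma>\<close> for \<open>u = |f|\<^sup>p\<close>, exchanging the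
  integrals and letting \<open>\<delta> \<rightarrow> 0\<close> gives \<open>\<integral> u d\<mu> \<ge> C \<integral> u d\<sigma>\<close> over the sphere. The function
  \<open>c \<mapsto> \<integral> |f(c\<zeta>)|\<^sup>p d\<sigma>(\<zeta>)\<close> on the closed unit disc is rotation invariant and has the sub-mean value
  property, so by the maximum principle its values are bounded by the one at \<open>1\<close>.
\<close>

subsection \<open>Unitary invariance of the surface measure\<close>

lemma Re_cinner: "Re (cinner z w) = z \<bullet> w"
  by (simp add: cinner_def inner_vec_def inner_complex_def)

lemma cinner_add_left: "cinner (x + y) z = cinner x z + cinner y z"
  and cinner_diff_left: "cinner (x - y) z = cinner x z - cinner y z"
  and cinner_diff_right: "cinner z (x - y) = cinner z x - cinner z y"
  and cinner_smult_left: "cinner (c *s x) z = c * cinner x z"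
  and cinner_smult_right: "cinner z (c *s x) = cnj c * cinner z x"
  by (simp_all add: cinner_def algebra_simps sum.distrib sum_subtractf sum_distrib_left)

lemma scaleR_eq_smult: "r *\<^sub>R x = of_real r *s (x :: complex^'n)"
  by (simp add: vec_eq_iff scaleR_conv_of_real[where 'a=complex])

lemma cinner_scaleR_left: "cinner (r *\<^sub>R x) z = of_real r * cinner x z"
  and cinner_scaleR_right: "cinner z (r *\<^sub>R x) = of_real r * cinner z x"
  by (simp_all add: scaleR_eq_smult cinner_smult_left cinner_smult_right)

lemma cnj_cinner: "cnj (cinner x y) = cinner y x"
  by (simp add: cinner_def mult.commute)

lemma cinner_self: "cinner x x = of_real ((norm x)\<^sup>2)"
proof (rule complex_eqI)
  show "Re (cinner x x) = Re (of_real ((norm x)\<^sup>2))"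
    by (simp add: Re_cinner power2_norm_eq_inner)
  have "cnj (cinner x x) = cinner x x" by (rule cnj_cinner)
  then show "Im (cinner x x) = Im (of_real ((norm x)\<^sup>2))"
    by (metis Im_complex_of_real Reals_cnj_iff complex_is_Real_iff)
qed

lemma norm_complex_smult: "norm (c *s x) = cmod c * norm (x :: complex^'n)"
  by (simp add: norm_vec_def L2_set_def norm_mult power_mult_distrib real_sqrt_mult
      flip: sum_distrib_left)

text \<open>Multiplying \<open>z\<close> by the conjugate phase of \<open>cinner z w\<close> makes
  the product real and nonnegative, so the Cauchy-Schwarz inequality of the real inner product
  applies.\<close>

lemma norm_cinner_le: "cmod (cinner z w) \<le> norm z * norm w"
proof -
  define c where "c = cnj (sgn (cinner z w))"
  have c: "cmod c \<le> 1" by (simp add: c_def norm_sgn)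
  have "cmod (cinner z w) = Re (c * cinner z w)"
  proof (cases "cinner z w = 0")
    case False
    have "c * cinner z w = of_real ((cmod (cinner z w))\<^sup>2) / of_real (cmod (cinner z w))"
      by (simp add: c_def complex_sgn_def scaleR_conv_of_real complex_norm_square 
          mult.commute divide_inverse del: of_real_power)
    then show ?thesis using False by (simp add: power2_eq_square)
  qed simp
  also have "\<dots> = (c *s z) \<bullet> w" by (simp add: cinner_smult_left flip: Re_cinner)
  also have "\<dots> \<le> norm (c *s z) * norm w" by (rule norm_cauchy_schwarz)
  also have "\<dots> \<le> norm z * norm w"
    by (simp add: norm_complex_smult c mult_left_le_one_le mult_right_mono)
  finally show ?thesis .
qed

lemma continuous_on_cinner [continuous_intros]:
  assumes "continuous_on S f" "continuous_on S g"
  shows "continuous_on S (\<lambda>x. cinner (f x) (g x))"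
  unfolding cinner_def by (intro continuous_intros assms)

text \<open>Links the two geometries: a non-isotropic ball of radius \<delta> lies within Euclidean
  distance \<open>sqrt (2 * \<delta>)\<close> of its centre, and points at a positive Euclidean
  distance keep \<open>1 - cinner z w\<close> away from 0.\<close>

lemma dist_square_le_cinner:
  assumes "norm z \<le> 1" "norm w \<le> 1"
  shows "(dist z w)\<^sup>2 \<le> 2 * cmod (1 - cinner z w)"
proof -
  have "(dist z w)\<^sup>2 = (norm z)\<^sup>2 + (norm w)\<^sup>2 - 2 * (z \<bullet> w)"
    by (simp add: dist_norm power2_norm_eq_inner inner_diff algebra_simps inner_commute)
  also have "\<dots> \<le> 1 + 1 - 2 * (z \<bullet> w)"
    using assms by (intro diff_mono add_mono power_le_one) auto
  also have "\<dots> = 2 * Re (1 - cinner z w)" by (simp add: Re_cinner)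
  also have "\<dots> \<le> 2 * cmod (1 - cinner z w)" by (intro mult_left_mono complex_Re_le_cmod) auto
  finally show ?thesis .
qed

lemma emeasure_distr_indicator:
  assumes "f \<in> measurable M N" "A \<in> sets N"
  shows "emeasure (distr M N f) A = (\<integral>\<^sup>+x. indicator A (f x) \<partial>M)"
  using assms by (simp add: nn_integral_distr flip: nn_integral_indicator)

text \<open>A double count without determinants. Let \<open>B\<close> be the unit ball, which
  \<open>T\<close> preserves, and integrate 1_A(T x) 1_B(T x + y) over x and y. Integrating over y
  first gives the measure of the preimage of \<open>A\<close> times that of \<open>B\<close>.
  Translating x by the preimage of -y turns the integrand into 1_A(T x - y) 1_B(T x), and
  integrating over y first now gives the measure of \<open>A\<close> times that of \<open>B\<close>.
  The factor of \<open>B\<close> is positive and finite, so it cancels.\<close>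

lemma distr_lborel_orthogonal:
  fixes T :: "'a::euclidean_space \<Rightarrow> 'a"
  assumes T: "orthogonal_transformation T"
  shows "distr lborel borel T = lborel"
proof -
  have lin: "linear T" and nT: "\<And>x. norm (T x) = norm x"
    using T by (auto simp: orthogonal_transformation_def orthogonal_transformation_norm)
  have cT: "continuous_on UNIV T" using lin by (simp add: linear_continuous_on linear_conv_bounded_linear)
  have [measurable]: "T \<in> borel_measurable borel" using cT by (rule borel_measurable_continuous_onI)
  obtain T' where T': "\<And>x. T (T' x) = x"
    using orthogonal_transformation_surj[OF T] by (metis surj_def)
  define B :: "'a set" where "B = ball 0 1"
  have [measurable]: "B \<in> sets borel" by (simp add: B_def)
  have B: "0 < emeasure lborel B" "emeasure lborel B < \<infinity>"
    unfolding B_def by (auto simp: emeasure_ball)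
  have "emeasure lborel A = emeasure (distr lborel borel T) A" if [measurable]: "A \<in> sets lborel" for A
  proof -
    have [measurable]: "A \<in> sets borel" using that by simp
    have "emeasure (distr lborel borel T) A * emeasure lborel B
        = (\<integral>\<^sup>+x. indicator A (T x) \<partial>lborel) * emeasure lborel B"
      by (simp add: emeasure_distr_indicator)
    also have "\<dots> = (\<integral>\<^sup>+x. indicator A (T x) * emeasure lborel B \<partial>lborel)"
      by (simp add: nn_integral_multc)
    also have "\<dots> = (\<integral>\<^sup>+x. (\<integral>\<^sup>+y. indicator A (T x) * indicator B (T x + y) \<partial>lborel) \<partial>lborel)"
    proof (rule nn_integral_cong)
      fix x
      have "emeasure lborel B = emeasure (distr lborel borel ((+) (T x))) B" by (simp add: lborel_distr_plus)
      also have "\<dots> = (\<integral>\<^sup>+y. indicator B (T x + y) \<partial>lborel)"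
        by (intro emeasure_distr_indicator) measurable
      finally show "indicator A (T x) * emeasure lborel B = (\<integral>\<^sup>+y. indicator A (T x) * indicator B (T x + y) \<partial>lborel)"
        by (simp add: nn_integral_cmult)
    qed
    also have "\<dots> = (\<integral>\<^sup>+y. (\<integral>\<^sup>+x. indicator A (T x) * indicator B (T x + y) \<partial>lborel) \<partial>lborel)"
      by (rule lborel_pair.Fubini') measurable
    also have "\<dots> = (\<integral>\<^sup>+y. (\<integral>\<^sup>+x. indicator A (T x - y) * indicator B (T x) \<partial>lborel) \<partial>lborel)"
    proof (rule nn_integral_cong)
      fix y
      have "T (- T' y + x) = T x - y" for x using linear_diff[OF lin] by (simp add: T')
      then show "(\<integral>\<^sup>+x. indicator A (T x) * indicator B (T x + y) \<partial>lborel) = (\<integral>\<^sup>+x. indicator A (T x - y) * indicator B (T x) \<partial>lborel)"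
        by (subst lborel_distr_plus[of "- T' y", symmetric]) (simp add: nn_integral_distr)
    qed
    also have "\<dots> = (\<integral>\<^sup>+x. (\<integral>\<^sup>+y. indicator A (T x - y) * indicator B (T x) \<partial>lborel) \<partial>lborel)"
      by (rule lborel_pair.Fubini') measurable
    also have "\<dots> = (\<integral>\<^sup>+x. emeasure lborel A * indicator B x \<partial>lborel)"
    proof (rule nn_integral_cong)
      fix x
      have "emeasure lborel A = emeasure (distr lborel borel (\<lambda>y. T x - y)) A"
        by (subst lborel_affine[of "-1" "T x"]) (simp_all add: density_1 one_ennreal_def[symmetric])
      also have "\<dots> = (\<integral>\<^sup>+y. indicator A (T x - y) \<partial>lborel)"
        by (intro emeasure_distr_indicator) measurable
      finally show "(\<integral>\<^sup>+y. indicator A (T x - y) * indicator B (T x) \<partial>lborel) = emeasure lborel A * indicator B x"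
        by (simp add: nn_integral_multc B_def nT indicator_def)
    qed
    also have "\<dots> = emeasure lborel A * emeasure lborel B"
      by (simp add: nn_integral_cmult)
    finally show ?thesis
      using B by (metis mult_divide_eq_ennreal order_less_irrefl infinity_ennreal_def)
  qed
  then show ?thesis by (intro measure_eqI[symmetric]) auto
qed

lemma space_sigma_sphere [simp]: "space sigma_sphere = UNIV"
  and sets_sigma_sphere [simp, measurable_cong]: "sets sigma_sphere = sets borel"
  by (simp_all add: sigma_sphere_def)

lemma emeasure_unit_ball_pos: "0 < emeasure lborel (ball (0::'a::euclidean_space) 1)"
  by (simp add: emeasure_ball)

lemma emeasure_unit_ball_finite: "emeasure lborel (ball (0::'a::euclidean_space) 1) \<noteq> \<infinity>"
  by (simp add: emeasure_ball)

lemma measurable_sgn [measurable]: "sgn \<in> borel_measurable (borel :: 'a::euclidean_space measure)"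
  unfolding sgn_div_norm by measurable

lemma emeasure_sigma_UNIV [simp]: "emeasure (sigma_sphere :: (complex^'n) measure) UNIV = 1"
proof -
  let ?B = "ball 0 1 :: (complex^'n) set"
  have "emeasure lborel ?B / emeasure lborel ?B = 1"
    using emeasure_unit_ball_pos[where 'a="complex^'n"] emeasure_unit_ball_finite[where 'a="complex^'n"]
    by (intro ennreal_divide_self) (auto simp: less_top[symmetric])
  then show ?thesis by (simp add: sigma_sphere_def emeasure_distr)
qed

interpretation sigma: finite_measure "sigma_sphere :: (complex^'n) measure"
  by (rule finite_measureI) simp

text \<open>Only an almost-everywhere statement: \<open>sgn 0 = 0\<close> is off the sphere, but the
  origin is a null set of the ball.\<close>

lemma AE_sigma_sphere: "AE \<zeta> in (sigma_sphere :: (complex^'n) measure). \<zeta> \<in> sphere 0 1"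
proof -
  have "AE x in uniform_measure lborel (ball (0::complex^'n) 1). x \<noteq> 0"
    using emeasure_unit_ball_pos[where 'a="complex^'n"]
    by (intro AE_uniform_measureI eventually_mono[OF AE_lborel_singleton[of 0]]) auto
  then show ?thesis
    unfolding sigma_sphere_def by (subst AE_distr_iff) (auto simp: norm_sgn elim: eventually_mono)
qed

text \<open>Stated with real linearity so that the theory of
  \<open>orthogonal_transformation\<close> applies: the real part of the preserved Hermitian product
  is the Euclidean inner product.\<close>

locale unitary =
  fixes T :: "complex^'n \<Rightarrow> complex^'n"
  assumes linear: "linear T" and cinner: "cinner (T z) (T w) = cinner z w"
begin

lemma orthogonal: "orthogonal_transformation T"
  by (simp add: orthogonal_transformation_def linear cinner flip: Re_cinner)

lemma norm_eq: "norm (T z) = norm z"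
  using orthogonal by (rule orthogonal_transformation_norm)

lemma measurable [measurable]: "T \<in> borel_measurable borel"
  by (intro borel_measurable_continuous_onI linear_continuous_on)
     (simp add: linear linear_conv_bounded_linear[symmetric])

text \<open>An orthogonal map preserves the uniform measure on the ball and commutes with the radial
  projection \<open>sgn\<close>, hence preserves the push-forward.\<close>

lemma distr_sigma: "distr sigma_sphere borel T = sigma_sphere"
proof -
  let ?U = "uniform_measure lborel (ball (0::complex^'n) 1)"
  have T_sgn: "T (sgn x) = sgn (T x)" for x
    by (simp add: sgn_div_norm norm_eq linear_cmul[OF linear])
  have "distr ?U borel T = ?U"
  proof (rule measure_eqI)
    fix A assume "A \<in> sets (distr ?U borel T)"
    then have [measurable]: "A \<in> sets borel" by simp
    have "T -` A \<in> sets borel" using measurable_sets_borel[OF measurable] by simp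
    have "emeasure lborel (ball 0 1 \<inter> T -` A) = emeasure lborel (T -` (ball 0 1 \<inter> A) \<inter> space lborel)"
      by (auto intro!: arg_cong[where f="emeasure lborel"] simp: norm_eq)
    also have "\<dots> = emeasure (distr lborel borel T) (ball 0 1 \<inter> A)" by (subst emeasure_distr) auto
    also have "\<dots> = emeasure lborel (ball 0 1 \<inter> A)" by (simp add: distr_lborel_orthogonal orthogonal)
    finally show "emeasure (distr ?U borel T) A = emeasure ?U A"
      using \<open>T -` A \<in> sets borel\<close> by (simp add: emeasure_distr)
  qed simp
  have "distr sigma_sphere borel T = distr ?U borel (\<lambda>x. T (sgn x))"
    unfolding sigma_sphere_def by (subst distr_distr) (auto simp: comp_def)
  also have "\<dots> = distr (distr ?U borel T) borel sgn"
    by (subst distr_distr) (auto simp: comp_def T_sgn)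
  finally show ?thesis
    by (simp add: \<open>distr ?U borel T = ?U\<close> sigma_sphere_def)
qed

lemma nn_integral_sigma:
  assumes [measurable]: "f \<in> borel_measurable borel"
  shows "(\<integral>\<^sup>+ \<zeta>. f (T \<zeta>) \<partial>sigma_sphere) = (\<integral>\<^sup>+ \<zeta>. f \<zeta> \<partial>sigma_sphere)"
  by (subst (2) distr_sigma[symmetric]) (simp add: nn_integral_distr)

end

lemma unitary_smult:
  assumes "cmod c = 1"
  shows "unitary ((*s) c)"
proof (rule unitary.intro)
  show "linear ((*s) c)"
    by (intro linearI) (simp_all add: vec_eq_iff algebra_simps)
  have "c * cnj c = 1" using assms by (simp add: complex_norm_square[symmetric])
  moreover have "cinner (c *s z) (c *s w) = (c * cnj c) * cinner z w" for z w
    by (simp add: cinner_smult_left cinner_smult_right)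
  ultimately show "cinner (c *s z) (c *s w) = cinner z w" for z w by simp
qed

lemma unitary_compose: "unitary S \<Longrightarrow> unitary T \<Longrightarrow> unitary (\<lambda>x. S (T x))"
  unfolding unitary_def using linear_compose[of T S] by (auto simp: comp_def)

text \<open>A complex Householder reflection along \<open>v = c *s x - y\<close>. Such a reflection
  carries \<open>c *s x\<close> to \<open>y\<close> only if their Hermitian product is real; the
  unimodular factor \<open>c\<close> arranges this first, and itself acts unitarily.\<close>

lemma unitary_transitive:
  fixes x y :: "complex^'n"
  assumes "norm x = norm y"
  obtains T where "unitary T" "T x = y"
proof -
  define c where "c = (if cinner x y = 0 then 1 else cnj (sgn (cinner x y)))"
  have c: "cmod c = 1" by (simp add: c_def norm_sgn)
  define v where "v = c *s x - y"
  have real: "c * cinner x y \<in> \<real>"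
  proof (cases "cinner x y = 0")
    case False
    have "c * cinner x y = of_real ((cmod (cinner x y))\<^sup>2) / of_real (cmod (cinner x y))"
      using False by (simp add: c_def complex_sgn_def scaleR_conv_of_real complex_norm_square 
          mult.commute divide_inverse del: of_real_power)
    then show ?thesis by (metis Reals_divide Reals_of_real)
  qed simp
  show ?thesis
  proof (cases "v = 0")
    case True
    then show ?thesis using that[OF unitary_smult[OF c]] by (simp add: v_def)
  next
    case False
    define N where "N = cinner v v"
    have N: "N \<noteq> 0" "cnj N = N" using False by (auto simp: N_def cinner_self)
    define R where "R z = z - (2 * cinner z v / N) *s v" for z
    have "unitary R"
    proof (rule unitary.intro)
      show "linear R"
        by (intro linearI)
           (auto simp: R_def vec_eq_iff cinner_add_left cinner_scaleR_left algebra_simps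
             add_divide_distrib scaleR_conv_of_real[where 'a=complex])
      fix z w
      define s t where "s = 2 * cinner z v / N" and "t = 2 * cinner w v / N"
      have s: "2 * cinner z v = s * N" using N by (simp add: s_def)
      have t: "2 * cinner v w = cnj t * N" using N by (simp add: t_def cnj_cinner)
      have R: "R z = z - s *s v" "R w = w - t *s v" by (simp_all add: R_def s_def t_def)
      have "2 * cinner (R z) (R w) = 2 * cinner z w - s * (2 * cinner v w) - cnj t * (2 * cinner z v) + 2 * (s * cnj t * N)"
        unfolding R N_def
        by (simp add: cinner_diff_left cinner_diff_right cinner_smult_left cinner_smult_right algebra_simps)
      also have "\<dots> = 2 * cinner z w"
        unfolding s t by (simp add: algebra_simps)
      finally show "cinner (R z) (R w) = cinner z w" by simp
    qed
    \<comment> \<open>Reality of the product and equality of the norms give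
      \<open>N = 2 * cinner (c *s x) v\<close>, so the reflection subtracts exactly \<open>v\<close>
      from \<open>c *s x\<close>.\<close>
    have sym: "cinner y (c *s x) = cinner (c *s x) y"
      using real by (metis Reals_cnj_iff cnj_cinner cinner_smult_left)
    have "cinner (c *s x) (c *s x) = cinner y y"
      using assms by (simp add: cinner_self norm_complex_smult c)
    then have "2 * cinner (c *s x) v = N"
      by (simp add: N_def v_def cinner_diff_left cinner_diff_right sym)
    then have "R (c *s x) = y" using N by (simp add: R_def v_def vec_eq_iff)
    then show ?thesis using that[OF unitary_compose[OF \<open>unitary R\<close> unitary_smult[OF c]]] by blast
  qed
qed

subsection \<open>Non-isotropic balls\<close>

lemma cinner_axis_left: "cinner (axis k 1) y = cnj (y $ k)"
proof -
  have "cinner (axis k 1) y = (\<Sum>i\<in>UNIV. if i = k then cnj (y $ i) else 0)"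
    unfolding cinner_def by (intro sum.cong) (auto simp: axis_def)
  then show ?thesis by simp
qed

text \<open>The box is anisotropic: size \<delta> in the one direction tangent to the complex line
  of the centre, size \<open>sqrt \<delta>\<close> in the remaining complex directions, whose effect
  on \<open>norm x - Re (x $ k)\<close> is only quadratic. With \<open>c = 1 / (8 n)\<close>, n the
  complex dimension, the n error terms of size at most 2 c^2 \<delta> add up to at most c \<delta> /
  4.\<close>

lemma sgn_in_nball_axis:
  fixes x :: "complex^'n"
  assumes \<delta>: "0 < \<delta>" "\<delta> \<le> 1" and c: "c = 1 / (8 * real CARD('n))"
  assumes x: "1/2 \<le> Re (x $ k)" "Re (x $ k) \<le> 3/4" "\<bar>Im (x $ k)\<bar> \<le> c * \<delta>"
    "\<And>i. i \<noteq> k \<Longrightarrow> \<bar>Re (x $ i)\<bar> \<le> c * sqrt \<delta>" "\<And>i. i \<noteq> k \<Longrightarrow> \<bar>Im (x $ i)\<bar> \<le> c * sqrt \<delta>"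
  shows "norm x < 1" and "sgn x \<in> nball (axis k 1) \<delta>"
proof -
  have n: "real CARD('n) \<ge> 1" by (simp add: Suc_le_eq)
  have c8: "0 < c" "c \<le> 1/8" using n by (auto simp: c field_simps)
  have sq: "(c * sqrt \<delta>)\<^sup>2 = c\<^sup>2 * \<delta>" using \<delta> by (simp add: power_mult_distrib)
  have "\<delta>\<^sup>2 \<le> \<delta>" using \<delta> by (simp add: power2_eq_square mult_left_le)
  have comp: "(cmod (x $ i))\<^sup>2 - (if i = k then (Re (x $ k))\<^sup>2 else 0) \<le> 2 * (c\<^sup>2 * \<delta>)" for i
  proof (cases "i = k")
    case True
    have "(Im (x $ k))\<^sup>2 \<le> (c * \<delta>)\<^sup>2" using x(3) by (meson abs_le_square_iff abs_ge_self order_trans)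
    also have "\<dots> \<le> c\<^sup>2 * \<delta>" using \<open>\<delta>\<^sup>2 \<le> \<delta>\<close> by (simp add: power_mult_distrib mult_left_mono)
    also have "\<dots> \<le> 2 * (c\<^sup>2 * \<delta>)" using \<delta> by simp
    finally show ?thesis using True by (simp add: cmod_power2)
  next
    case False
    have "(Re (x $ i))\<^sup>2 \<le> (c * sqrt \<delta>)\<^sup>2" "(Im (x $ i))\<^sup>2 \<le> (c * sqrt \<delta>)\<^sup>2"
      using x(4,5)[OF False] by (meson abs_le_square_iff abs_ge_self order_trans)+
    then show ?thesis using False by (simp add: cmod_power2 sq)
  qed
  have "(norm x)\<^sup>2 - (Re (x $ k))\<^sup>2 = (\<Sum>i\<in>UNIV. (cmod (x $ i))\<^sup>2 - (if i = k then (Re (x $ k))\<^sup>2 else 0))"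
    by (simp add: norm_vec_def L2_set_def sum_nonneg sum_subtractf)
  also have "\<dots> \<le> (\<Sum>i\<in>(UNIV :: 'n set). 2 * (c\<^sup>2 * \<delta>))"
    by (intro sum_mono comp)
  also have "\<dots> = 2 * (c * \<delta>) * (c * real CARD('n))" by (simp add: power2_eq_square)
  also have "c * real CARD('n) = 1/8" using n by (simp add: c)
  finally have le: "(norm x)\<^sup>2 - (Re (x $ k))\<^sup>2 \<le> c * \<delta> / 4" by (simp add: mult.commute)
  have c\<delta>: "c * \<delta> \<le> \<delta> / 8" "c * \<delta> \<le> 1/8" using c8 \<delta> mult_mono[of c "1/8" \<delta> 1] by auto
  have "(Re (x $ k))\<^sup>2 \<le> (3/4)\<^sup>2" using x by (intro power_mono) auto
  with le c\<delta> have "(norm x)\<^sup>2 < 1\<^sup>2" by (simp add: power2_eq_square)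
  then show "norm x < 1" by (rule power2_less_imp_less) simp
  have Rele: "Re (x $ k) \<le> norm x" by (meson complex_Re_le_cmod component_le_norm_cart Finite_Cartesian_Product.norm_nth_le order_trans)
  then have nx: "norm x \<ge> 1/2" using x by simp
  \<comment> \<open>Since \<open>norm x + Re (x $ k)\<close> is at least 1, the difference of the
    squares controls the difference itself.\<close>
  have "(norm x - Re (x $ k)) * 1 \<le> (norm x - Re (x $ k)) * (norm x + Re (x $ k))"
    using Rele x nx by (intro mult_left_mono) auto
  also have "\<dots> = (norm x)\<^sup>2 - (Re (x $ k))\<^sup>2" by (simp add: power2_eq_square algebra_simps)
  finally have d: "norm x - Re (x $ k) \<le> \<delta> / 32" using le c\<delta> by simp
  have "cmod (of_real (norm x) - cnj (x $ k)) \<le> \<bar>norm x - Re (x $ k)\<bar> + \<bar>Im (x $ k)\<bar>"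
    using cmod_le[of "of_real (norm x) - cnj (x $ k)"] by simp
  also have "\<dots> \<le> \<delta> / 2" using d x(3) c\<delta> Rele \<delta> by linarith
  finally have m: "cmod (of_real (norm x) - cnj (x $ k)) \<le> \<delta> / 2" .
  have "1 - cinner (axis k 1) (sgn x) = (of_real (norm x) - cnj (x $ k)) / of_real (norm x)"
  proof -
    have "cinner (axis k 1) (sgn x) = cnj (x $ k) / of_real (norm x)"
      by (simp add: cinner_axis_left sgn_div_norm scaleR_conv_of_real[where 'a=complex] divide_inverse mult.commute)
    moreover have "norm x \<noteq> 0" using nx by linarith
    ultimately show ?thesis by (simp add: diff_divide_distrib)
  qed
  then have "cmod (1 - cinner (axis k 1) (sgn x)) = cmod (of_real (norm x) - cnj (x $ k)) / norm x"
    by (simp add: norm_divide)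
  also have "\<dots> \<le> (\<delta>/2) / (1/2)" using m nx \<delta> by (intro frac_le) auto
  finally show "sgn x \<in> nball (axis k 1) \<delta>"
    using nx by (auto simp: nball_def norm_sgn)
qed

lemma closed_nball: "closed (nball \<zeta> \<delta>)"
proof -
  have "nball \<zeta> \<delta> = sphere 0 1 \<inter> {\<xi>. cmod (1 - cinner \<zeta> \<xi>) \<le> \<delta>}" by (auto simp: nball_def)
  then show ?thesis by (auto intro!: closed_Int closed_Collect_le continuous_intros)
qed

lemma nball_sets [measurable]: "nball \<zeta> \<delta> \<in> sets borel"
  by (intro borel_closed closed_nball)

lemma sgn_vimage_nball_sets: "sgn -` nball \<zeta> \<delta> \<in> sets borel"
  by (rule measurable_sets_borel[OF measurable_sgn nball_sets])

lemma norm_one_minus_cinner_commute: "cmod (1 - cinner z w) = cmod (1 - cinner w z)"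
  using complex_mod_cnj[of "1 - cinner w z"] by (simp add: cnj_cinner)

lemma nball_commute: "\<xi> \<in> nball \<zeta> \<delta> \<longleftrightarrow> norm \<xi> = 1 \<and> cmod (1 - cinner \<xi> \<zeta>) \<le> \<delta>"
  by (auto simp: nball_def norm_one_minus_cinner_commute[of \<zeta>])

lemma emeasure_nball_eq:
  fixes \<zeta> \<xi> :: "complex^'n"
  assumes "norm \<zeta> = norm \<xi>"
  shows "emeasure sigma_sphere (nball \<zeta> \<delta>) = emeasure sigma_sphere (nball \<xi> \<delta>)"
proof -
  obtain T where "unitary T" and T: "T \<zeta> = \<xi>" using unitary_transitive[OF assms] .
  interpret unitary T by fact
  have "indicator (nball \<xi> \<delta>) (T x) = (indicator (nball \<zeta> \<delta>) x :: ennreal)" for x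
    by (auto simp: indicator_def nball_def norm_eq cinner simp flip: T)
  then show ?thesis
    using nn_integral_sigma[of "indicator (nball \<xi> \<delta>)"] by simp
qed

text \<open>As \<sigma> is a push-forward from the ball, it suffices to fit a box of volume
  comparable to \<delta>^n into the cone over a non-isotropic ball, n being the complex dimension.
  This is done for a centre on a coordinate axis; unitary invariance moves the centre.\<close>

lemma emeasure_nball_ge:
  obtains c where "c > 0" 
    "\<And>\<zeta> \<delta>. \<lbrakk>norm \<zeta> = 1; 0 < \<delta>; \<delta> \<le> 1\<rbrakk> \<Longrightarrow> 
       emeasure sigma_sphere (nball (\<zeta> :: complex^'n) \<delta>) \<ge> ennreal (c * \<delta> ^ CARD('n))"
proof -
  define n where "n = CARD('n)"
  have n: "n \<ge> 1" by (simp add: n_def Suc_le_eq)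
  define c where "c = 1 / (8 * real n)"
  have c: "c > 0" using n by (simp add: c_def)
  obtain k :: 'n where True by simp
  define V where "V = measure lborel (ball (0 :: complex^'n) 1)"
  have V: "V > 0" unfolding V_def by (rule content_ball_pos) simp
  have emV: "emeasure lborel (ball (0 :: complex^'n) 1) = ennreal V"
    unfolding V_def using emeasure_unit_ball_finite by (intro emeasure_eq_ennreal_measure) auto
  \<comment> \<open>The volume of the box below divided by the volume of the unit ball, with the
    factor \<delta>^n removed.\<close>
  define C where "C = (1/4) * (2 * c) * (2 * c) ^ (2 * n - 2) / V"
  have ge: "emeasure sigma_sphere (nball (axis k 1 :: complex^'n) \<delta>) \<ge> ennreal (C * \<delta> ^ n)"
    if \<delta>: "0 < \<delta>" "\<delta> \<le> 1" for \<delta>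
  proof -
    define a :: "complex^'n" where "a = (\<chi> i. if i = k then Complex (1/2) (- c * \<delta>) else Complex (- c * sqrt \<delta>) (- c * sqrt \<delta>))"
    define b :: "complex^'n" where "b = (\<chi> i. if i = k then Complex (3/4) (c * \<delta>) else Complex (c * sqrt \<delta>) (c * sqrt \<delta>))"
    have inner: "x \<bullet> axis i 1 = Re (x $ i)" "x \<bullet> axis i \<i> = Im (x $ i)" for x :: "complex^'n" and i
      by (simp_all add: inner_axis inner_complex_def)
    have Basis: "Basis = (\<Union>i. {axis i 1, axis i \<i> :: complex^'n})"
      by (auto simp: Basis_vec_def Basis_complex_def)
    have box: "sgn x \<in> nball (axis k 1) \<delta> \<and> x \<in> ball 0 1" if "x \<in> cbox a b" for x
    proof -
      have *: "Re (a $ i) \<le> Re (x $ i)" "Re (x $ i) \<le> Re (b $ i)" "Im (a $ i) \<le> Im (x $ i)" "Im (x $ i) \<le> Im (b $ i)" for i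
        using that by (auto simp: mem_box Basis inner)
      show ?thesis
      proof -
        have 1: "1/2 \<le> Re (x $ k)" "Re (x $ k) \<le> 3/4" "\<bar>Im (x $ k)\<bar> \<le> c * \<delta>"
          using *[of k] by (simp_all add: a_def b_def abs_le_iff minus_le_iff)
        have 2: "\<bar>Re (x $ i)\<bar> \<le> c * sqrt \<delta>" "\<bar>Im (x $ i)\<bar> \<le> c * sqrt \<delta>" if "i \<noteq> k" for i
          using *[of i] that by (simp_all add: a_def b_def abs_le_iff minus_le_iff)
        from sgn_in_nball_axis[OF \<delta> c_def[unfolded n_def] 1 2] show ?thesis by simp
      qed
    qed
    have ne: "axis k 1 \<noteq> (axis k \<i> :: complex^'n)" by (simp add: axis_eq_axis)
    have D: "card (Basis :: (complex^'n) set) = 2 * n" by (simp add: n_def)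
    \<comment> \<open>The two real directions of coordinate \<open>k\<close> give the sides 1/4 and
      2 c \<delta>; each of the other 2n - 2 directions gives a side
      \<open>2 * c * sqrt \<delta>\<close>. The powers of \<delta> combine to 1 + (n - 1) =
      n.\<close>
    let ?R = "Basis - {axis k 1, axis k \<i> :: complex^'n}"
    have R: "(b - a) \<bullet> u = 2 * c * sqrt \<delta>" if "u \<in> ?R" for u
      using that by (auto simp: Basis a_def b_def inner axis_eq_axis inner_diff_left)
    have "(\<Prod>u\<in>Basis. (b - a) \<bullet> u) = ((b - a) \<bullet> axis k 1) * ((b - a) \<bullet> axis k \<i>) * (\<Prod>u\<in>?R. (b - a) \<bullet> u)"
    proof -
      have "Basis = insert (axis k 1) (insert (axis k \<i> :: complex^'n) ?R)" by (auto simp: Basis)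
      then show ?thesis using ne by (subst prod.insert[symmetric] | simp add: mult.assoc)+
    qed
    also have "(\<Prod>u\<in>?R. (b - a) \<bullet> u) = (2 * c * sqrt \<delta>) ^ card ?R"
      using R by (simp only: prod.cong[OF refl R] prod_constant)
    also have "card ?R = 2 * n - 2" using ne D by (subst card_Diff_subset) (auto simp: Basis)
    also have "(2 * c * sqrt \<delta>) ^ (2 * n - 2) = (2 * c) ^ (2 * n - 2) * \<delta> ^ (n - 1)"
    proof -
      have "2 * n - 2 = 2 * (n - 1)" by simp
      then have "sqrt \<delta> ^ (2 * n - 2) = \<delta> ^ (n - 1)" using \<delta> by (simp only: power_mult) simp
      then show ?thesis by (simp add: power_mult_distrib)
    qed
    also have "(b - a) \<bullet> axis k 1 = 1/4" by (simp add: inner a_def b_def inner_diff_left)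
    also have "(b - a) \<bullet> axis k \<i> = 2 * c * \<delta>" by (simp add: inner a_def b_def inner_diff_left)
    finally have vol: "(\<Prod>u\<in>Basis. (b - a) \<bullet> u) = C * V * \<delta> ^ n"
      using n V by (cases n) (auto simp: C_def)
    have pos: "\<forall>u\<in>Basis. a \<bullet> u \<le> b \<bullet> u" using \<delta> c by (auto simp: Basis a_def b_def inner)
    have "ennreal (C * V * \<delta> ^ n) = emeasure lborel (cbox a b)"
      by (simp add: emeasure_lborel_cbox_eq pos vol)
    also have "\<dots> \<le> emeasure lborel (ball 0 1 \<inter> sgn -` nball (axis k 1) \<delta>)"
    proof (intro emeasure_mono)
      show "ball 0 1 \<inter> sgn -` nball (axis k 1) \<delta> \<in> sets (lborel :: (complex^'n) measure)"
        by (auto intro: sets.Int sgn_vimage_nball_sets)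
    qed (use box in auto)
    finally have 1: "ennreal (C * V * \<delta> ^ n) \<le> emeasure lborel (ball 0 1 \<inter> sgn -` nball (axis k 1) \<delta> :: (complex^'n) set)" .
    have "emeasure sigma_sphere (nball (axis k 1 :: complex^'n) \<delta>) 
        = emeasure lborel (ball 0 1 \<inter> sgn -` nball (axis k 1) \<delta> :: (complex^'n) set) / ennreal V"
      unfolding sigma_sphere_def emV[symmetric] by (simp add: emeasure_distr sgn_vimage_nball_sets)
    also have "\<dots> \<ge> ennreal (C * V * \<delta> ^ n) / ennreal V" by (rule divide_right_mono_ennreal[OF 1])
    also have "ennreal (C * V * \<delta> ^ n) / ennreal V = ennreal (C * \<delta> ^ n)"
      using V \<delta> c by (subst divide_ennreal) (auto simp: C_def)
    finally show ?thesis .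
  qed
  show ?thesis
  proof (rule that[of C])
    show "C > 0" using c V by (simp add: C_def)
    show "emeasure sigma_sphere (nball (\<zeta> :: complex^'n) \<delta>) \<ge> ennreal (C * \<delta> ^ CARD('n))"
      if "norm \<zeta> = 1" "0 < \<delta>" "\<delta> \<le> 1" for \<zeta> \<delta>
      using ge[OF that(2,3)] emeasure_nball_eq[of \<zeta> "axis k 1" \<delta>] that(1) by (simp add: n_def)
  qed
qed

subsection \<open>The sub-mean value property of powers of holomorphic functions\<close>

lemma holomorphic_norm_mean_le:
  assumes h: "h holomorphic_on ball 0 1" and s: "0 < s" "s < 1"
  shows "cmod (h 0) \<le> integral {0..1} (\<lambda>t. cmod (h (of_real s * circlepath 0 1 t)))"
proof -
  have sub: "cball 0 s \<subseteq> ball (0::complex) 1" using s by auto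
  have cont: "continuous_on (cball 0 s) h"
    using h sub holomorphic_on_imp_continuous_on holomorphic_on_subset by blast
  have "((\<lambda>u. h u / (u - 0)) has_contour_integral (2 * of_real pi * \<i> * h 0)) (circlepath 0 s)"
    using s by (intro Cauchy_integral_circlepath cont holomorphic_on_subset[OF h]) auto
  then have "((\<lambda>t. 2 * of_real pi * \<i> * h (of_real s * circlepath 0 1 t)) has_integral (2 * of_real pi * \<i> * h 0)) {0..1}"
    unfolding has_contour_integral vector_derivative_circlepath using s
    by (simp add: circlepath field_simps)
  from has_integral_mult_right[OF this, of "1 / (2 * of_real pi * \<i>)"]
  have *: "((\<lambda>t. h (of_real s * circlepath 0 1 t)) has_integral h 0) {0..1}" by simp
  have "continuous_on {0..1} (\<lambda>t. cmod (h (of_real s * circlepath 0 1 t)))"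
    by (intro continuous_intros continuous_on_compose2[OF cont])
       (use s in \<open>auto simp: circlepath norm_mult intro!: continuous_intros\<close>)
  then show ?thesis
    unfolding integral_unique[OF *, symmetric]
    by (intro integral_norm_bound_integral has_integral_integrable[OF *] integrable_continuous_real) auto
qed

lemma cmod_circlepath_01 [simp]: "cmod (circlepath 0 1 t) = 1"
  by (simp add: circlepath)

text \<open>Because \<open>cmod (b i) \<le> 1\<close>, every factor \<open>1 - b i * z\<close> has
  positive real part in the open disc. The product of their principal \<open>p\<close>-th powers is
  therefore holomorphic there with value 1 at the origin, and the mean value inequality applies on
  circles of radius \<open>s < 1\<close>.\<close>

lemma prod_linear_mean_ge:
  assumes p: "0 < p" and b: "\<And>i. i < n \<Longrightarrow> cmod (b i) \<le> 1"
  shows "1 \<le> integral {0..1} (\<lambda>t. \<Prod>i<n. cmod (1 - b i * circlepath 0 1 t) powr p)"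
proof -
  define I where "I s = integral (cbox 0 1) (\<lambda>t. \<Prod>i<n. cmod (1 - b i * (of_real s * circlepath 0 1 t)) powr p)" for s :: real
  have "continuous_on ({0..1} \<times> cbox 0 1) (\<lambda>(s, t). \<Prod>i<n. cmod (1 - b i * (of_real s * circlepath 0 1 t)) powr p)"
    unfolding case_prod_unfold circlepath using p by (intro continuous_intros continuous_on_powr') auto
  then have contI: "continuous_on {0..1} I"
    unfolding I_def by (rule integral_continuous_on_param)
  have le: "1 \<le> I s" if s: "0 < s" "s < 1" for s
  proof -
    define h where "h z = (\<Prod>i<n. (1 - b i * z) powr of_real p)" for z
    have pos: "0 < Re (1 - b i * z)" if "cmod z < 1" "i < n" for z i
    proof -
      have "cmod (b i * z) \<le> 1 * cmod z" unfolding norm_mult using b[OF that(2)] by (intro mult_right_mono) auto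
      then show ?thesis using complex_Re_le_cmod[of "b i * z"] that by simp
    qed
    have nz: "1 - b i * z \<notin> \<real>\<^sub>\<le>\<^sub>0" if "cmod z < 1" "i < n" for z i
      using pos[OF that] by (auto simp: complex_nonpos_Reals_iff simp del: minus_complex.simps)
    have "h holomorphic_on ball 0 1"
      unfolding h_def using nz by (intro holomorphic_intros) auto
    from holomorphic_norm_mean_le[OF this s]
    have "1 \<le> integral {0..1} (\<lambda>t. cmod (h (of_real s * circlepath 0 1 t)))" by (simp add: h_def)
    also have "\<dots> = I s"
      unfolding I_def h_def cbox_interval prod_norm[symmetric]
    proof (intro integral_cong prod.cong refl)
      fix t i assume "i \<in> {..<n}"
      moreover have "cmod (of_real s * circlepath 0 1 t) < 1" using s by (simp add: norm_mult)
      ultimately have "1 - b i * (of_real s * circlepath 0 1 t) \<noteq> 0" using pos by fastforce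
      then show "cmod ((1 - b i * (of_real s * circlepath 0 1 t)) powr of_real p) = cmod (1 - b i * (of_real s * circlepath 0 1 t)) powr p"
        by (simp add: norm_powr_real_powr')
    qed
    finally show ?thesis .
  qed
  \<comment> \<open>A factor may vanish on the unit circle itself, so radius 1 is reached only as a
    limit, by continuity of the means.\<close>
  have "(\<lambda>k. I (1 - 1 / real (k + 2))) \<longlonglongrightarrow> I 1"
  proof (rule continuous_on_tendsto_compose[OF contI])
    show "(\<lambda>k. 1 - 1 / real (k + 2)) \<longlonglongrightarrow> 1" by real_asymp
  qed auto
  then have "1 \<le> I 1"
    by (rule tendsto_lowerbound) (auto intro!: always_eventually le)
  then show ?thesis by (simp add: I_def)
qed

text \<open>Zeros in the open disc are reflected in the unit circle: this leaves the modulus on the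
  circle unchanged and can only increase it at the centre.\<close>
lemma reflect_zero:
  obtains d b where "cmod b \<le> 1" "cmod a \<le> cmod d" 
    "\<And>z. cmod z = 1 \<Longrightarrow> cmod (z - a) = cmod d * cmod (1 - b * z)"
proof (cases "cmod a < 1")
  case True
  have "cmod (z - a) = cmod (1 - cnj a * z)" if "cmod z = 1" for z
  proof -
    have "z * cnj z = 1" using that by (simp add: complex_norm_square[symmetric])
    then have "z - a = z * cnj (1 - cnj a * z)" by (simp add: algebra_simps)
    then have "cmod (z - a) = cmod z * cmod (cnj (1 - cnj a * z))" by (metis norm_mult)
    then show ?thesis using that by (simp only: complex_mod_cnj)
  qed
  then show ?thesis using True that[of "cnj a" 1] by simp
next
  case False
  then have "a \<noteq> 0" by auto
  then have "z - a = (- a) * (1 - (1/a) * z)" for z by (simp add: field_simps)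
  then have "cmod (z - a) = cmod (- a) * cmod (1 - (1/a) * z)" for z by (metis norm_mult)
  then show ?thesis using False that[of "1/a" "-a"] \<open>a \<noteq> 0\<close> by (simp add: norm_divide divide_le_eq_1)
qed

text \<open>Reflect every root lying in the open disc. On the circle the modulus of \<open>P\<close>
  is unchanged, at the centre it does not decrease, and the new factors are, up to constants, those
  of \<open>prod_linear_mean_ge\<close>. The number \<open>K\<close> is the \<open>p\<close>-th
  power of the new modulus at the centre.\<close>

lemma poly_powr_mean_ge:
  fixes P :: "complex poly"
  assumes p: "0 < p"
  shows "cmod (poly P 0) powr p \<le> integral {0..1} (\<lambda>t. cmod (poly P (circlepath 0 1 t)) powr p)"
proof -
  obtain a where a: "smult (lead_coeff P) (\<Prod>i<degree P. [:- a i, 1:]) = P" using complex_poly_decompose' .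
  define n where "n = degree P"
  have P: "poly P z = lead_coeff P * (\<Prod>i<n. z - a i)" for z
    by (subst a[symmetric]) (simp add: poly_prod n_def)
  have "\<forall>i. \<exists>d b. cmod b \<le> 1 \<and> cmod (a i) \<le> cmod d \<and> (\<forall>z. cmod z = 1 \<longrightarrow> cmod (z - a i) = cmod d * cmod (1 - b * z))"
    using reflect_zero by metis
  then obtain d b where b: "\<And>i. cmod (b i) \<le> 1" and d: "\<And>i. cmod (a i) \<le> cmod (d i)"
    and db: "\<And>i z. cmod z = 1 \<Longrightarrow> cmod (z - a i) = cmod (d i) * cmod (1 - b i * z)" by metis
  define K where "K = (cmod (lead_coeff P) * (\<Prod>i<n. cmod (d i))) powr p"
  have "cmod (poly P 0) powr p = (cmod (lead_coeff P) * (\<Prod>i<n. cmod (a i))) powr p"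
    by (simp add: P norm_mult prod_norm[symmetric])
  also have "\<dots> \<le> K"
    unfolding K_def using p d by (intro powr_mono2 mult_left_mono prod_mono mult_nonneg_nonneg prod_nonneg) auto
  also have "K = K * 1" by simp
  also have "\<dots> \<le> K * integral {0..1} (\<lambda>t. \<Prod>i<n. cmod (1 - b i * circlepath 0 1 t) powr p)"
    using b p by (intro mult_left_mono prod_linear_mean_ge) (auto simp: K_def)
  also have "\<dots> = integral {0..1} (\<lambda>t. K * (\<Prod>i<n. cmod (1 - b i * circlepath 0 1 t) powr p))" by simp
  also have "\<dots> = integral {0..1} (\<lambda>t. cmod (poly P (circlepath 0 1 t)) powr p)"
  proof (intro integral_cong)
    fix t
    have "cmod (poly P (circlepath 0 1 t)) = cmod (lead_coeff P) * ((\<Prod>i<n. cmod (d i)) * (\<Prod>i<n. cmod (1 - b i * circlepath 0 1 t)))"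
      by (simp add: P norm_mult prod_norm[symmetric] db prod.distrib)
    then show "K * (\<Prod>i<n. cmod (1 - b i * circlepath 0 1 t) powr p) = cmod (poly P (circlepath 0 1 t)) powr p"
      by (simp add: K_def powr_mult prod_nonneg prod_powr_distrib)
  qed
  finally show ?thesis .
qed

text \<open>The polynomial case passes to the limit along Taylor polynomials at \<open>a\<close>.
  These work for every \<open>p > 0\<close>, including zeros of \<open>g\<close> and
  \<open>p < 1\<close>.\<close>

lemma holomorphic_powr_mean_ge:
  assumes p: "0 < p" and g: "g holomorphic_on ball a R" and \<rho>: "0 < \<rho>" "\<rho> < R"
  shows "cmod (g a) powr p \<le> integral {0..1} (\<lambda>t. cmod (g (circlepath a \<rho> t)) powr p)"
proof -
  \<comment> \<open>The coefficients of \<open>g (a + \<rho> * z)\<close> in powers of z, so that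
    the circle of radius \<rho> becomes the unit circle.\<close>
  define c where "c k = (deriv ^^ k) g a / fact k * of_real \<rho> ^ k" for k
  define Q where "Q n = (\<Sum>k<n. monom (c k) k)" for n
  have polyQ: "poly (Q n) z = (\<Sum>k<n. c k * z ^ k)" for n z by (simp add: Q_def poly_sum poly_monom)
  have sums: "(\<lambda>k. c k * z ^ k) sums g (a + of_real \<rho> * z)" if "cmod z = 1" for z
  proof -
    have "a + of_real \<rho> * z \<in> ball a R" using that \<rho> by (simp add: dist_norm norm_mult)
    from holomorphic_power_series[OF g this] show ?thesis by (simp add: c_def power_mult_distrib mult_ac)
  qed
  \<comment> \<open>Convergence at a slightly larger radius makes the series absolutely summable at
    radius \<rho>; its sum \<open>B\<close> is the dominating constant.\<close>
  obtain s where s: "\<rho> < s" "s < R" using \<rho>(2) dense by blast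
  have "summable (\<lambda>k. norm ((deriv ^^ k) g a / fact k * of_real \<rho> ^ k))"
  proof (rule powser_insidea)
    have "a + of_real s \<in> ball a R" using s \<rho> by (simp add: dist_norm)
    from holomorphic_power_series[OF g this] 
    show "summable (\<lambda>k. (deriv ^^ k) g a / fact k * of_real s ^ k)" by (simp add: sums_iff)
    show "norm (of_real \<rho> :: complex) < norm (of_real s :: complex)" using s \<rho> by simp
  qed
  then have summ: "summable (\<lambda>k. cmod (c k))" by (simp add: c_def)
  define B where "B = (\<Sum>k. cmod (c k))"
  have B: "cmod (poly (Q n) z) \<le> B" if "cmod z = 1" for n z
  proof -
    have "cmod (poly (Q n) z) \<le> (\<Sum>k<n. cmod (c k))"
      unfolding polyQ by (rule order_trans[OF norm_sum]) (simp add: norm_mult norm_power that)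
    also have "\<dots> \<le> B" unfolding B_def by (intro sum_le_suminf summ) auto
    finally show ?thesis .
  qed
  have cp: "circlepath a \<rho> t = a + of_real \<rho> * circlepath 0 1 t" for t by (simp add: circlepath)
  have lim: "(\<lambda>n. integral {0..1} (\<lambda>t. cmod (poly (Q n) (circlepath 0 1 t)) powr p)) 
     \<longlonglongrightarrow> integral {0..1} (\<lambda>t. cmod (g (circlepath a \<rho> t)) powr p)"
  proof (rule dominated_convergence(2))
    show "(\<lambda>t. cmod (poly (Q n) (circlepath 0 1 t)) powr p) integrable_on {0..1}" for n
      unfolding circlepath using p by (intro integrable_continuous_real continuous_on_powr' continuous_intros) auto
    show "(\<lambda>t. B powr p) integrable_on {0..1::real}" by (intro integrable_continuous_real continuous_intros)
    show "norm (cmod (poly (Q n) (circlepath 0 1 t)) powr p) \<le> B powr p" for n t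
      using B[of "circlepath 0 1 t" n] p by (auto intro!: powr_mono2)
    show "(\<lambda>n. cmod (poly (Q n) (circlepath 0 1 t)) powr p) \<longlonglongrightarrow> cmod (g (circlepath a \<rho> t)) powr p" for t
      unfolding polyQ cp using sums[of "circlepath 0 1 t"] p
      by (intro tendsto_powr' tendsto_norm) (auto simp: sums_def)
  qed
  have "eventually (\<lambda>n. cmod (g a) powr p \<le> integral {0..1} (\<lambda>t. cmod (poly (Q n) (circlepath 0 1 t)) powr p)) sequentially"
    using eventually_gt_at_top[of 0]
  proof eventually_elim
    case (elim n)
    have "poly (Q n) 0 = (\<Sum>k<n. if k = 0 then g a else 0)" unfolding polyQ by (intro sum.cong) (auto simp: c_def power_0_left)
    also have "\<dots> = g a" using elim by simp
    finally show ?case using poly_powr_mean_ge[OF p, of "Q n"] by simp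
  qed
  with lim show ?thesis by (rule tendsto_lowerbound) simp
qed

text \<open>Among all points where the maximum is attained, take \<open>b\<close> of largest
  modulus. Were it interior, the sub-mean value property would force \<Phi> to equal its maximum on
  a whole circle around \<open>b\<close>, and that circle contains points farther from the
  origin.\<close>

lemma sub_mean_value_max_principle:
  fixes \<Phi> :: "complex \<Rightarrow> real"
  assumes cont: "continuous_on (cball 0 1) \<Phi>"
    and mean: "\<And>a \<rho>. \<lbrakk>0 < \<rho>; cmod a + \<rho> < 1\<rbrakk> \<Longrightarrow> \<Phi> a \<le> integral {0..1} (\<lambda>t. \<Phi> (circlepath a \<rho> t))"
  obtains b where "cmod b = 1" "\<And>x. cmod x \<le> 1 \<Longrightarrow> \<Phi> x \<le> \<Phi> b"
proof -
  obtain m where m: "m \<in> cball 0 1" "\<And>x. x \<in> cball 0 1 \<Longrightarrow> \<Phi> x \<le> \<Phi> m"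
    using continuous_attains_sup[OF _ _ cont] by auto
  define S where "S = {x \<in> cball 0 1. \<Phi> x = \<Phi> m}"
  have "closed S" unfolding S_def
    using continuous_closed_preimage_constant[OF cont closed_cball] by simp
  then have "compact S" unfolding S_def
    by (metis (no_types, lifting) bounded_cball bounded_subset compact_eq_bounded_closed mem_Collect_eq subsetI)
  moreover have "m \<in> S" using m by (simp add: S_def)
  ultimately obtain b where b: "b \<in> S" "\<And>x. x \<in> S \<Longrightarrow> cmod x \<le> cmod b"
    using continuous_attains_sup[of S cmod] continuous_on_norm_id by blast
  have max: "\<Phi> x \<le> \<Phi> b" if "cmod x \<le> 1" for x using b(1) m(2)[of x] that by (simp add: S_def)
  have "cmod b = 1"
  proof (rule ccontr)
    assume "cmod b \<noteq> 1"
    then have b1: "cmod b < 1" using b(1) by (simp add: S_def)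
    define \<rho> where "\<rho> = (1 - cmod b) / 2"
    have \<rho>: "0 < \<rho>" "cmod b + \<rho> < 1" using b1 by (auto simp: \<rho>_def field_simps)
    have cp: "cmod (circlepath b \<rho> t) \<le> 1" for t
      unfolding circlepath using \<rho> by (intro order_trans[OF norm_triangle_ineq]) (simp add: norm_mult)
    define D where "D t = \<Phi> b - \<Phi> (circlepath b \<rho> t)" for t
    have contP: "continuous_on {0..1} (\<lambda>t. \<Phi> (circlepath b \<rho> t))"
      by (rule continuous_on_compose2[OF cont]) (use cp in \<open>auto simp: circlepath intro!: continuous_intros\<close>)
    have contD: "continuous_on {0..1} D" unfolding D_def by (intro continuous_intros contP)
    have D0: "0 \<le> D t" for t using max cp by (simp add: D_def)
    have "integral {0..1} D = \<Phi> b - integral {0..1} (\<lambda>t. \<Phi> (circlepath b \<rho> t))"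
      unfolding D_def using contP by (subst integral_diff) (auto intro: integrable_continuous_real)
    then have "integral {0..1} D \<le> 0" using mean[OF \<rho>] by simp
    moreover have "0 \<le> integral {0..1} D" by (intro integral_nonneg integrable_continuous_real contD D0)
    ultimately have "(D has_integral 0) (cbox 0 1)"
      using integrable_integral[OF integrable_continuous_real[OF contD]] by simp
    then have D_eq: "D t = 0" if "t \<in> {0..1}" for t
      using has_integral_0_cbox_imp_0[of 0 1 D t] contD D0 that by auto
    \<comment> \<open>The outward unit direction at \<open>b\<close>, with an arbitrary choice when
      \<open>b = 0\<close>; moving by \<rho> along it raises the modulus by exactly \<rho>.\<close>
    define u where "u = (if b = 0 then 1 else sgn b)"
    have u: "cmod u = 1" "b = of_real (cmod b) * u" by (auto simp: u_def norm_sgn) (simp add: sgn_eq)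
    have "b + of_real \<rho> * u \<in> path_image (circlepath b \<rho>)" using \<rho> u by (simp add: dist_norm norm_mult)
    then obtain t where t: "t \<in> {0..1}" "b + of_real \<rho> * u = circlepath b \<rho> t" by (auto simp: path_image_def)
    have "b + of_real \<rho> * u \<in> S"
      using D_eq[OF t(1)] cp[of t] b(1) unfolding D_def t(2) S_def by simp
    moreover have "cmod (b + of_real \<rho> * u) = cmod b + \<rho>"
    proof -
      have "b + of_real \<rho> * u = of_real (cmod b + \<rho>) * u" by (subst u(2)) (simp add: algebra_simps)
      then show ?thesis using \<rho> u by (simp only: norm_mult norm_of_real) simp
    qed
    ultimately show False using b(2) \<rho> by fastforce
  qed
  with max show ?thesis using that by blast
qed

section \<open>Bounding the Hardy norm by the boundary integral\<close>

lemma borel_measurable_smult [measurable]: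
  fixes g :: "'a \<Rightarrow> complex^'n"
  assumes "f \<in> borel_measurable M" "g \<in> borel_measurable M"
  shows "(\<lambda>x. f x *s g x) \<in> borel_measurable M"
  by (rule borel_measurable_continuous_Pair[OF assms])
     (auto simp: vector_scalar_mult_def intro!: continuous_intros)

lemma borel_measurable_cinner [measurable]:
  assumes "f \<in> borel_measurable M" "g \<in> borel_measurable M"
  shows "(\<lambda>x. cinner (f x) (g x)) \<in> borel_measurable M"
  by (rule borel_measurable_continuous_Pair[OF assms]) (intro continuous_intros)

lemma bounded_linear_smult_left: "bounded_linear (\<lambda>c::complex. c *s (x :: complex^'n))"
  by (rule bounded_linear_intro[where K="norm x"])
     (simp_all add: vec_eq_iff algebra_simps norm_complex_smult)

text \<open>Complex homogeneity turns the real derivative along the slice into multiplication by the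
  complex number \<open>L \<zeta>\<close>.\<close>

lemma holo_on_slice:
  assumes f: "holo_on f (ball 0 1)" and \<zeta>: "norm \<zeta> = 1"
  shows "(\<lambda>c. f (c *s \<zeta>)) holomorphic_on ball 0 1"
  unfolding holomorphic_on_def
proof
  fix c :: complex assume "c \<in> ball 0 1"
  then have "c *s \<zeta> \<in> ball 0 1" using \<zeta> by (simp add: norm_complex_smult)
  then obtain L where L: "(f has_derivative L) (at (c *s \<zeta>))" "\<And>c x. L (c *s x) = c * L x"
    using f unfolding holo_on_def by metis
  have "((\<lambda>c. f (c *s \<zeta>)) has_derivative (\<lambda>h. L (h *s \<zeta>))) (at c)"
    using has_derivative_compose[OF bounded_linear_imp_has_derivative[OF bounded_linear_smult_left] L(1)] .
  then have "((\<lambda>c. f (c *s \<zeta>)) has_field_derivative L \<zeta>) (at c)"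
    unfolding has_field_derivative_def L(2) by (simp add: mult_commute_abs)
  then show "(\<lambda>c. f (c *s \<zeta>)) field_differentiable at c within ball 0 1"
    using field_differentiable_def field_differentiable_at_within by blast
qed

text \<open>All the means in \<open>Hp_pnorm\<close> are values of one function \<Phi> on the closed
  unit disc, taken at the points of (0,1). Dominated convergence makes \<Phi> continuous, and
  averaging the one-variable inequality on slices gives the sub-mean value property, so \<Phi> is
  largest at some \<open>b\<close> on the circle.\<close>

lemma Hp_pnorm_le_boundary:
  fixes f :: "complex^'n \<Rightarrow> complex"
  assumes p: "0 < p" and cont: "continuous_on (cball 0 1) f" and holo: "holo_on f (ball 0 1)"
  shows "Hp_pnorm p f \<le> (\<integral>\<^sup>+ \<zeta>\<in>sphere 0 1. ennreal (cmod (f \<zeta>) powr p) \<partial>sigma_sphere)"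
proof -
  \<comment> \<open>Cutting off outside the closed ball gives a bounded, globally Borel function, as
    Fubini and the integrability arguments require; \<open>f\<close> is controlled only on the
    closed ball.\<close>
  define u where "u z = indicator (cball 0 1) z *\<^sub>R (cmod (f z) powr p)" for z
  have cont_p: "continuous_on (cball 0 1) (\<lambda>z. cmod (f z) powr p)"
    using p by (intro continuous_on_powr' continuous_intros cont) auto
  then have cont_u: "continuous_on (cball 0 1) u" by (rule continuous_on_eq) (simp add: u_def)
  have u_eq: "u z = cmod (f z) powr p" if "norm z \<le> 1" for z using that by (simp add: u_def)
  have [measurable]: "u \<in> borel_measurable borel"
    unfolding u_def by (intro borel_measurable_continuous_on_indicator cont_p) simp
  have u0: "0 \<le> u z" for z by (simp add: u_def)
  obtain M where M: "\<And>z. z \<in> cball 0 1 \<Longrightarrow> cmod (f z) powr p \<le> M"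
    using continuous_attains_sup[OF compact_cball _ cont_p] by (metis cball_eq_empty not_one_less_zero)
  have M0: "0 \<le> M" using M[of 0] by (simp add: order_trans[OF powr_ge_zero])
  have uM: "u z \<le> M" for z using M[of z] M0 by (auto simp: u_def indicator_def)
  define \<Phi> where "\<Phi> c = (\<integral>\<zeta>. u (c *s \<zeta>) \<partial>sigma_sphere)" for c
  have int: "integrable sigma_sphere (\<lambda>\<zeta>. u (c *s \<zeta>))" for c
    by (rule sigma.integrable_const_bound[where B=M]) (use u0 uM in auto)
  have \<Phi>: "(\<integral>\<^sup>+\<zeta>. ennreal (u (c *s \<zeta>)) \<partial>sigma_sphere) = ennreal (\<Phi> c)" for c
    unfolding \<Phi>_def by (intro nn_integral_eq_integral int AE_I2 u0)
  have \<Phi>0: "0 \<le> \<Phi> c" for c unfolding \<Phi>_def by (intro Bochner_Integration.integral_nonneg u0)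
  have cont\<Phi>: "continuous_on (cball 0 1) \<Phi>"
    unfolding continuous_on_sequentially
  proof safe
    fix x :: "nat \<Rightarrow> complex" and c assume c: "\<forall>n. x n \<in> cball 0 1" "c \<in> cball 0 1" "x \<longlonglongrightarrow> c"
    show "(\<Phi> \<circ> x) \<longlonglongrightarrow> \<Phi> c"
      unfolding \<Phi>_def comp_def
    proof (rule integral_dominated_convergence[where w="\<lambda>_. M"])
      show "AE \<zeta> in sigma_sphere. (\<lambda>n. u (x n *s \<zeta>)) \<longlonglongrightarrow> u (c *s \<zeta>)"
        using AE_sigma_sphere
      proof eventually_elim
        case (elim \<zeta>)
        have "(\<lambda>n. x n *s \<zeta>) \<longlonglongrightarrow> c *s \<zeta>"
          using bounded_linear.tendsto[OF bounded_linear_smult_left c(3)] .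
        then show ?case
          by (rule continuous_on_tendsto_compose[OF cont_u]) (use c elim in \<open>auto simp: norm_complex_smult\<close>)
      qed
    qed (use u0 uM in auto)
  qed
  obtain b where b: "cmod b = 1" "\<And>c. cmod c \<le> 1 \<Longrightarrow> \<Phi> c \<le> \<Phi> b"
  proof (rule sub_mean_value_max_principle[OF cont\<Phi>])
    fix a \<rho> assume \<rho>: "0 < \<rho>" "cmod a + \<rho> < 1"
    have cp: "cmod (circlepath a \<rho> t) \<le> 1" for t
      unfolding circlepath using \<rho> by (intro order_trans[OF norm_triangle_ineq]) (simp add: norm_mult)
    have cont_cp: "continuous_on {0..1} (circlepath a \<rho>)" unfolding circlepath by (intro continuous_intros)
    have [measurable]: "circlepath a \<rho> \<in> borel_measurable borel"
      unfolding circlepath by (intro borel_measurable_continuous_onI continuous_intros)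
    \<comment> \<open>Passes between the gauge integral of the sub-mean value property and the
      Lebesgue integral to which Fubini applies.\<close>
    have int_ind: "(\<integral>\<^sup>+t. ennreal (k t) * indicator {0..1} t \<partial>lborel) = ennreal (integral {0..1} k)"
      if "continuous_on {0..1} k" "\<And>t. 0 \<le> k t" for k :: "real \<Rightarrow> real"
      by (rule nn_integral_has_integral_lebesgue')
         (use that in \<open>auto intro!: integrable_integral integrable_continuous_real\<close>)
    interpret pair_sigma_finite "sigma_sphere :: (complex^'n) measure" "lborel :: real measure"
      by unfold_locales
    have "ennreal (\<Phi> a) = (\<integral>\<^sup>+\<zeta>. ennreal (u (a *s \<zeta>)) \<partial>sigma_sphere)" by (simp add: \<Phi>)
    also have "\<dots> \<le> (\<integral>\<^sup>+\<zeta>. (\<integral>\<^sup>+t. ennreal (u (circlepath a \<rho> t *s \<zeta>)) * indicator {0..1} t \<partial>lborel) \<partial>sigma_sphere)"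
    proof (rule nn_integral_mono_AE)
      show "AE \<zeta> in sigma_sphere. ennreal (u (a *s \<zeta>)) \<le> (\<integral>\<^sup>+t. ennreal (u (circlepath a \<rho> t *s \<zeta>)) * indicator {0..1} t \<partial>lborel)"
        using AE_sigma_sphere
      proof eventually_elim
        case (elim \<zeta>)
        then have \<zeta>: "norm \<zeta> = 1" by simp
        have "(\<lambda>c. f (c *s \<zeta>)) holomorphic_on ball a (1 - cmod a)"
        proof (rule holomorphic_on_subset[OF holo_on_slice[OF holo \<zeta>]])
          show "ball a (1 - cmod a) \<subseteq> ball 0 1" by (simp add: subset_ball dist_norm ball_subset_ball_iff)
        qed
        then have "cmod (f (a *s \<zeta>)) powr p \<le> integral {0..1} (\<lambda>t. cmod (f (circlepath a \<rho> t *s \<zeta>)) powr p)"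
          using \<rho> by (intro holomorphic_powr_mean_ge[OF p]) auto
        then have "u (a *s \<zeta>) \<le> integral {0..1} (\<lambda>t. u (circlepath a \<rho> t *s \<zeta>))"
          using cp \<rho> \<zeta> by (simp add: u_eq norm_complex_smult)
        moreover have "continuous_on {0..1} (\<lambda>t. u (circlepath a \<rho> t *s \<zeta>))"
        proof (rule continuous_on_compose2[OF cont_u])
          show "continuous_on {0..1} (\<lambda>t. circlepath a \<rho> t *s \<zeta>)"
            using bounded_linear.continuous_on[OF bounded_linear_smult_left cont_cp] .
        qed (use cp \<zeta> in \<open>auto simp: norm_complex_smult\<close>)
        ultimately show ?case using u0 by (subst int_ind) (auto intro: ennreal_leI)
      qed
    qed
    also have "\<dots> = (\<integral>\<^sup>+t. (\<integral>\<^sup>+\<zeta>. ennreal (u (circlepath a \<rho> t *s \<zeta>)) * indicator {0..1} t \<partial>sigma_sphere) \<partial>lborel)"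
      by (rule Fubini'[symmetric]) measurable
    also have "\<dots> = (\<integral>\<^sup>+t. ennreal (\<Phi> (circlepath a \<rho> t)) * indicator {0..1} t \<partial>lborel)"
      by (simp add: nn_integral_multc \<Phi>)
    also have "\<dots> = ennreal (integral {0..1} (\<lambda>t. \<Phi> (circlepath a \<rho> t)))"
      by (intro int_ind \<Phi>0 continuous_on_compose2[OF cont\<Phi> cont_cp]) (use cp in auto)
    finally show "\<Phi> a \<le> integral {0..1} (\<lambda>t. \<Phi> (circlepath a \<rho> t))"
      by (subst (asm) ennreal_le_iff)
         (auto intro!: integral_nonneg integrable_continuous_real continuous_on_compose2[OF cont\<Phi> cont_cp] \<Phi>0 simp: cp)
  qed auto
  \<comment> \<open>Multiplication by the unimodular \<open>b\<close> is unitary, so the maximum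
    equals the value at 1, which is the boundary integral.\<close>
  have "ennreal (\<Phi> b) = (\<integral>\<^sup>+\<zeta>. ennreal (u \<zeta>) \<partial>sigma_sphere)"
    unfolding \<Phi>[symmetric] by (rule unitary.nn_integral_sigma[OF unitary_smult[OF b(1)]]) measurable
  also have "\<dots> = (\<integral>\<^sup>+ \<zeta>\<in>sphere 0 1. ennreal (cmod (f \<zeta>) powr p) \<partial>sigma_sphere)"
    by (rule nn_integral_cong_AE) (use AE_sigma_sphere in eventually_elim, simp add: u_eq)
  finally have \<Phi>b: "ennreal (\<Phi> b) = \<dots>" .
  show ?thesis
    unfolding Hp_pnorm_def \<Phi>b[symmetric]
  proof (rule SUP_least)
    fix r :: real assume r: "r \<in> {0<..<1}"
    have "(\<integral>\<^sup>+ \<zeta>. ennreal (cmod (f (r *\<^sub>R \<zeta>)) powr p) \<partial>sigma_sphere) = (\<integral>\<^sup>+\<zeta>. ennreal (u (of_real r *s \<zeta>)) \<partial>sigma_sphere)"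
      by (rule nn_integral_cong_AE)
         (use AE_sigma_sphere in eventually_elim, use r in \<open>simp add: u_eq scaleR_eq_smult norm_complex_smult\<close>)
    also have "\<dots> \<le> ennreal (\<Phi> b)" unfolding \<Phi> using r by (intro ennreal_leI b(2)) auto
    finally show "(\<integral>\<^sup>+ \<zeta>. ennreal (cmod (f (r *\<^sub>R \<zeta>)) powr p) \<partial>sigma_sphere) \<le> ennreal (\<Phi> b)" .
  qed
qed

subsection \<open>Measures dominating the surface measure\<close>

text \<open>Integrate \<open>u \<zeta>\<close> over the pairs (\<zeta>, z) with
  \<open>z \<in> nball \<zeta> \<delta>\<close> against \<sigma> and \<mu>. One order of integration
  brings in the hypothesis on balls. In the other order \<open>u \<zeta>\<close> is within
  \<open>e\<close> of \<open>u z\<close>, leaving the \<sigma>-measure of a ball around z. That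
  measure is the same for all centres and cancels.\<close>

lemma nn_integral_sphere_le_of_nball:
  fixes \<mu> :: "(complex^'n) measure" and u :: "complex^'n \<Rightarrow> real"
  assumes sets [measurable_cong]: "sets \<mu> = sets borel" and fin: "finite_measure \<mu>"
    and le: "\<And>\<zeta> \<delta>. \<lbrakk>norm \<zeta> = 1; 0 < \<delta>\<rbrakk> \<Longrightarrow> C * emeasure sigma_sphere (nball \<zeta> \<delta>) \<le> emeasure \<mu> (nball \<zeta> \<delta>)"
    and u: "continuous_on (sphere 0 1) u" and u0: "\<And>z. 0 \<le> u z"
  shows "C * (\<integral>\<^sup>+\<zeta>\<in>sphere 0 1. ennreal (u \<zeta>) \<partial>sigma_sphere) \<le> (\<integral>\<^sup>+z\<in>sphere 0 1. ennreal (u z) \<partial>\<mu>)"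
proof -
  interpret \<mu>: finite_measure \<mu> by fact
  interpret pair_sigma_finite \<mu> "sigma_sphere :: (complex^'n) measure" by unfold_locales
  have [measurable]: "sphere (0 :: complex^'n) 1 \<in> sets borel" by (simp add: borel_closed)
  define g where "g z = ennreal (u z) * indicator (sphere 0 1) z" for z
  have "(\<lambda>z. indicator (sphere 0 1) z *\<^sub>R u z) \<in> borel_measurable borel"
    by (intro borel_measurable_continuous_on_indicator u) simp
  then have "(\<lambda>z. ennreal (indicator (sphere 0 1) z *\<^sub>R u z)) \<in> borel_measurable borel" by measurable
  moreover have "(\<lambda>z. ennreal (indicator (sphere 0 1) z *\<^sub>R u z)) = g" by (auto simp: g_def indicator_def)
  ultimately have [measurable]: "g \<in> borel_measurable borel" by simp
  obtain k :: 'n where True by simp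
  let ?e = "axis k 1 :: complex^'n"
  have approx: "C * (\<integral>\<^sup>+\<zeta>. g \<zeta> \<partial>sigma_sphere) \<le> (\<integral>\<^sup>+z. g z \<partial>\<mu>) + ennreal e * emeasure \<mu> (sphere 0 1)" if e: "0 < e" for e
  proof -
    have "uniformly_continuous_on (sphere 0 1) u" using u by (intro compact_uniformly_continuous) auto
    then obtain d where d: "0 < d" "\<And>x y. \<lbrakk>norm x = 1; norm y = 1; dist y x < d\<rbrakk> \<Longrightarrow> dist (u y) (u x) < e"
      using e unfolding uniformly_continuous_on_def by (metis mem_sphere_0)
    \<comment> \<open>Chosen so that the bound 2 \<delta> on the squared Euclidean distance is below
      d^2; the cap 1 keeps \<delta> in the range of \<open>emeasure_nball_ge\<close>, which makes
      the common measure \<open>s\<close> nonzero.\<close>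
    define \<delta> where "\<delta> = min 1 (d\<^sup>2 / 4)"
    have \<delta>: "0 < \<delta>" "\<delta> \<le> 1" "2 * \<delta> < d\<^sup>2" using d(1) by (auto simp: \<delta>_def min_def)
    have near: "u \<zeta> \<le> u z + e" if "\<zeta> \<in> nball z \<delta>" "norm z = 1" for \<zeta> z
    proof -
      have \<zeta>: "norm \<zeta> = 1" using that by (simp add: nball_def)
      have "(dist \<zeta> z)\<^sup>2 \<le> 2 * cmod (1 - cinner z \<zeta>)"
        using dist_square_le_cinner[of z \<zeta>] that \<zeta> by (simp add: dist_commute)
      also have "\<dots> < d\<^sup>2" using that \<delta> by (simp add: nball_def)
      finally have "dist \<zeta> z < d" using d(1) by (simp add: power2_less_imp_less)
      from d(2)[OF that(2) \<zeta> this] show ?thesis by (simp add: dist_real_def)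
    qed
    define s where "s = emeasure sigma_sphere (nball ?e \<delta>)"
    have s: "emeasure sigma_sphere (nball \<zeta> \<delta>) = s" if "norm \<zeta> = 1" for \<zeta> :: "complex^'n"
      unfolding s_def using that by (intro emeasure_nball_eq) simp
    have s0: "s \<noteq> 0"
    proof -
      obtain c where c: "c > 0" "\<And>(\<zeta> :: complex^'n) \<delta>. \<lbrakk>norm \<zeta> = 1; 0 < \<delta>; \<delta> \<le> 1\<rbrakk> \<Longrightarrow>
          emeasure sigma_sphere (nball \<zeta> \<delta>) \<ge> ennreal (c * \<delta> ^ CARD('n))"
        using emeasure_nball_ge[where 'n='n] by blast
      moreover have "ennreal (c * \<delta> ^ CARD('n)) \<le> s" unfolding s_def using \<delta> by (intro c(2)) auto
      moreover have "0 < ennreal (c * \<delta> ^ CARD('n))" using c(1) \<delta>(1) by simp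
      ultimately show ?thesis by (auto simp del: ennreal_less_zero_iff)
    qed
    have sfin: "s \<noteq> top" unfolding s_def by (simp add: sigma.emeasure_finite)
    have ind: "indicator (nball \<zeta> \<delta>) z = (if norm z = 1 \<and> cmod (1 - cinner \<zeta> z) \<le> \<delta> then 1 else 0 :: ennreal)" for \<zeta> z
      by (simp add: nball_def indicator_def)
    have "s * (C * (\<integral>\<^sup>+\<zeta>. g \<zeta> \<partial>sigma_sphere)) = (\<integral>\<^sup>+\<zeta>. (C * s) * g \<zeta> \<partial>sigma_sphere)"
      by (simp add: nn_integral_cmult mult_ac)
    also have "\<dots> \<le> (\<integral>\<^sup>+\<zeta>. emeasure \<mu> (nball \<zeta> \<delta>) * g \<zeta> \<partial>sigma_sphere)"
    proof (rule nn_integral_mono)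
      fix \<zeta> show "(C * s) * g \<zeta> \<le> emeasure \<mu> (nball \<zeta> \<delta>) * g \<zeta>"
        using le[of \<zeta> \<delta>] s[of \<zeta>] \<delta> by (auto simp: g_def indicator_def intro!: mult_right_mono)
    qed
    also have "\<dots> = (\<integral>\<^sup>+\<zeta>. (\<integral>\<^sup>+z. indicator (nball \<zeta> \<delta>) z * g \<zeta> \<partial>\<mu>) \<partial>sigma_sphere)"
      by (subst nn_integral_multc) (auto simp: sets)
    also have "\<dots> = (\<integral>\<^sup>+z. (\<integral>\<^sup>+\<zeta>. indicator (nball \<zeta> \<delta>) z * g \<zeta> \<partial>sigma_sphere) \<partial>\<mu>)"
      unfolding ind by (rule Fubini') measurable
    also have "\<dots> \<le> (\<integral>\<^sup>+z. s * (g z + ennreal e * indicator (sphere 0 1) z) \<partial>\<mu>)"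
    proof (rule nn_integral_mono)
      fix z
      show "(\<integral>\<^sup>+\<zeta>. indicator (nball \<zeta> \<delta>) z * g \<zeta> \<partial>sigma_sphere) \<le> s * (g z + ennreal e * indicator (sphere 0 1) z)"
      proof (cases "norm z = 1")
        case False
        then have "indicator (nball \<zeta> \<delta>) z = (0::ennreal)" for \<zeta> by (simp add: nball_def)
        then show ?thesis by simp
      next
        case True
        have "indicator (nball \<zeta> \<delta>) z * g \<zeta> \<le> indicator (nball z \<delta>) \<zeta> * ennreal (u z + e)" for \<zeta>
        proof (cases "z \<in> nball \<zeta> \<delta> \<and> norm \<zeta> = 1")
          case True
          then have "\<zeta> \<in> nball z \<delta>"
            by (simp add: nball_def norm_one_minus_cinner_commute[of z])
          then show ?thesis using near \<open>norm z = 1\<close> True by (simp add: g_def ennreal_leI)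
        qed (auto simp: g_def indicator_def)
        then have "(\<integral>\<^sup>+\<zeta>. indicator (nball \<zeta> \<delta>) z * g \<zeta> \<partial>sigma_sphere) \<le> (\<integral>\<^sup>+\<zeta>. indicator (nball z \<delta>) \<zeta> * ennreal (u z + e) \<partial>sigma_sphere)"
          by (rule nn_integral_mono)
        also have "\<dots> = s * ennreal (u z + e)" using s[OF True] by (simp add: nn_integral_multc)
        finally show ?thesis using True u0 e by (simp add: g_def ennreal_plus)
      qed
    qed
    also have "\<dots> = s * (\<integral>\<^sup>+z. g z + ennreal e * indicator (sphere 0 1) z \<partial>\<mu>)"
      by (rule nn_integral_cmult) measurable
    also have "\<dots> = s * ((\<integral>\<^sup>+z. g z \<partial>\<mu>) + ennreal e * emeasure \<mu> (sphere 0 1))"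
      by (subst nn_integral_add) (auto simp: nn_integral_cmult_indicator sets)
    finally show ?thesis using s0 sfin by (simp add: ennreal_mult_le_mult_iff)
  qed
  have "C * (\<integral>\<^sup>+\<zeta>. g \<zeta> \<partial>sigma_sphere) \<le> (\<integral>\<^sup>+z. g z \<partial>\<mu>)"
  proof (rule ennreal_le_epsilon)
    fix e :: real assume e: "0 < e"
    \<comment> \<open>The error of \<open>approx\<close> is multiplied by the mass \<open>m\<close>
      of the sphere, so it is used with \<open>e / (1 + m)\<close>, which is defined also for mass
      zero.\<close>
    define m where "m = measure \<mu> (sphere 0 1)"
    have m: "0 \<le> m" by (simp add: m_def)
    have "ennreal (e / (1 + m)) * emeasure \<mu> (sphere 0 1) = ennreal (e / (1 + m) * m)"
      using e m ennreal_mult[of "e / (1 + m)" m] by (simp only: \<mu>.emeasure_eq_measure m_def) simp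
    also have "\<dots> \<le> ennreal e" using e m by (intro ennreal_leI) (simp add: field_simps)
    finally have "ennreal (e / (1 + m)) * emeasure \<mu> (sphere 0 1) \<le> ennreal e" .
    moreover have "0 < e / (1 + m)" using e m by simp
    ultimately show "C * (\<integral>\<^sup>+\<zeta>. g \<zeta> \<partial>sigma_sphere) \<le> (\<integral>\<^sup>+z. g z \<partial>\<mu>) + ennreal e"
      using approx[of "e / (1 + m)"] by (meson add_left_mono order_trans)
  qed
  then show ?thesis unfolding g_def .
qed

subsection \<open>The kernels\<close>

lemma norm_one_minus_cinner_ge: "1 - norm z * norm w \<le> cmod (1 - cinner z w)"
  using norm_cinner_le[of z w] norm_triangle_ineq2[of 1 "cinner z w"] by simp

text \<open>On the singular set both sides are 0 by the conventions for \<open>inverse\<close> and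
  \<open>powr\<close>, given \<open>0 < l\<close>.\<close>

lemma kern_powr:
  fixes z w :: "complex^'n"
  assumes "0 < l"
  shows "cmod (kern w z ^ l) powr p = cmod (1 - cinner z w) powr - (real CARD('n) * real l * p)"
proof (cases "1 - cinner z w = 0")
  case False
  then have pos: "0 < cmod (1 - cinner z w)" by simp
  have "cmod (kern w z ^ l) = cmod (1 - cinner z w) powr - (real CARD('n) * real l)"
    using pos by (simp add: kern_def norm_power norm_inverse powr_minus power_inverse powr_realpow 
       flip: power_mult of_nat_mult)
  then show ?thesis by (simp add: powr_powr)
qed (use assms in \<open>simp add: kern_def\<close>)

text \<open>Since \<open>cmod (1 - cinner \<zeta> z)\<close> is symmetric in its arguments, this is
  both the mean over the sphere of a kernel power with parameter z and the integral, at a fixed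
  point z, over the parameter \<zeta>. The first reading yields the Hardy norm, the second is used
  in (ii) to (iii).\<close>

definition kernel_mean :: "real \<Rightarrow> complex^'n \<Rightarrow> ennreal" where
  "kernel_mean a z = (\<integral>\<^sup>+\<zeta>. ennreal (cmod (1 - cinner \<zeta> z) powr - a) \<partial>sigma_sphere)"

lemma kernel_mean_cong_norm:
  fixes z w :: "complex^'n"
  assumes "norm z = norm w"
  shows "kernel_mean a z = kernel_mean a w"
proof -
  obtain T where "unitary T" and T: "T z = w" using unitary_transitive[OF assms] .
  interpret unitary T by fact
  have "kernel_mean a w = (\<integral>\<^sup>+\<zeta>. ennreal (cmod (1 - cinner (T \<zeta>) (T z)) powr - a) \<partial>sigma_sphere)"
    unfolding kernel_mean_def T by (rule nn_integral_sigma[symmetric]) measurable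
  then show ?thesis by (simp add: cinner kernel_mean_def)
qed

lemma powr_one_minus_cinner_le:
  assumes "0 \<le> a" "norm z * norm w \<le> \<rho>" "\<rho> < 1"
  shows "cmod (1 - cinner z w) powr - a \<le> (1 - \<rho>) powr - a"
  using assms norm_one_minus_cinner_ge[of z w] by (intro powr_mono2') auto

lemma kernel_mean_le:
  fixes z :: "complex^'n"
  assumes "0 \<le> a" "norm z < 1"
  shows "kernel_mean a z \<le> ennreal ((1 - norm z) powr - a)"
proof -
  have "kernel_mean a z \<le> (\<integral>\<^sup>+\<zeta>. ennreal ((1 - norm z) powr - a) \<partial>(sigma_sphere :: (complex^'n) measure))"
    unfolding kernel_mean_def
    by (rule nn_integral_mono_AE, use AE_sigma_sphere in eventually_elim)
       (use assms in \<open>auto intro!: ennreal_leI powr_one_minus_cinner_le\<close>)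
  then show ?thesis by simp
qed

lemma tendsto_kernel_mean:
  fixes z :: "nat \<Rightarrow> complex^'n"
  assumes a: "0 \<le> a" and z: "z \<longlonglongrightarrow> w" "\<And>k. norm (z k) \<le> \<rho>" and \<rho>: "\<rho> < 1"
  shows "(\<lambda>k. kernel_mean a (z k)) \<longlonglongrightarrow> kernel_mean a w"
  unfolding kernel_mean_def
proof (rule nn_integral_dominated_convergence[where w="\<lambda>_. ennreal ((1 - \<rho>) powr - a)"])
  show "AE \<zeta> in sigma_sphere. ennreal (cmod (1 - cinner \<zeta> (z k)) powr - a) \<le> ennreal ((1 - \<rho>) powr - a)" for k
    using AE_sigma_sphere
    by eventually_elim (use a z \<rho> in \<open>auto intro!: ennreal_leI powr_one_minus_cinner_le\<close>)
  show "AE \<zeta> in sigma_sphere. (\<lambda>k. ennreal (cmod (1 - cinner \<zeta> (z k)) powr - a)) \<longlonglongrightarrow> ennreal (cmod (1 - cinner \<zeta> w) powr - a)"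
    using AE_sigma_sphere
  proof eventually_elim
    case (elim \<zeta>)
    have w: "norm w \<le> \<rho>" using z by (intro LIMSEQ_le_const2[OF tendsto_norm]) auto
    have "cmod (1 - cinner \<zeta> w) \<noteq> 0" using norm_one_minus_cinner_ge[of \<zeta> w] elim w \<rho> by auto
    moreover have "(\<lambda>k. cinner \<zeta> (z k)) \<longlonglongrightarrow> cinner \<zeta> w"
      by (rule continuous_on_tendsto_compose[OF _ z(1), of UNIV]) (auto intro!: continuous_intros)
    ultimately show ?case
      by (intro tendsto_ennrealI tendsto_powr tendsto_norm tendsto_diff tendsto_const) auto
  qed
qed (auto simp: ennreal_mult_less_top)

context
  fixes p :: real and l :: nat
  assumes p: "0 < p" and l: "0 < l"
begin

lemma Hp_pnorm_kern: 
  fixes w :: "complex^'n"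
  assumes a: "a = real CARD('n) * real l * p"
  shows "Hp_pnorm p (\<lambda>z. kern w z ^ l) = (SUP r\<in>{0<..<1}. kernel_mean a (r *\<^sub>R w))"
  unfolding Hp_pnorm_def kernel_mean_def kern_powr[OF l] a by (simp add: cinner_scaleR_left cinner_scaleR_right)

lemma Hp_pnorm_kern_cong_norm:
  fixes w w' :: "complex^'n"
  assumes "norm w = norm w'"
  shows "Hp_pnorm p (\<lambda>z. kern w z ^ l) = Hp_pnorm p (\<lambda>z. kern w' z ^ l)"
  unfolding Hp_pnorm_kern[OF refl]
  using assms by (intro SUP_cong kernel_mean_cong_norm refl) simp

text \<open>By unitary invariance \<open>z\<close> may be replaced by \<open>t *\<^sub>R w\<close>
  with \<open>t\<close> in [0,1]. The supremum in the Hardy norm covers only radii strictly between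
  0 and 1, so the endpoints are reached by continuity of the means.\<close>

lemma kernel_mean_le_Hp_pnorm_kern:
  fixes z w :: "complex^'n"
  assumes w: "norm z \<le> norm w" "norm w < 1"
  shows "kernel_mean (real CARD('n) * real l * p) z \<le> Hp_pnorm p (\<lambda>z. kern w z ^ l)"
proof (cases "w = 0")
  case False
  define a where "a = real CARD('n) * real l * p"
  have a: "0 \<le> a" using p by (simp add: a_def)
  define t where "t = norm z / norm w"
  have t: "0 \<le> t" "t \<le> 1" using w by (auto simp: t_def divide_le_eq_1)
  \<comment> \<open>A convex combination of \<open>t\<close> and 1/2 with weight 1/(k+2) on 1/2:
    strictly inside (0,1) even when \<open>t\<close> is 0 or 1.\<close>
  define s where "s k = t + (1/2 - t) / real (k + 2)" for k
  have "0 < s k \<and> s k < 1" for k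
  proof -
    define q where "q = 1 / real (k + 2)"
    have q: "0 < q" "q < 1" by (auto simp: q_def)
    have "s k = t * (1 - q) + q / 2" by (simp add: s_def q_def algebra_simps diff_divide_distrib)
    moreover have "0 \<le> t * (1 - q)" using t q by simp
    moreover have "t * (1 - q) \<le> 1 - q" using t q by (intro mult_left_le_one_le) auto
    ultimately have "0 < s k" "s k < 1" using q by linarith+
    then show ?thesis ..
  qed
  then have s: "0 < s k" "s k < 1" for k by auto
  have "s \<longlonglongrightarrow> t" unfolding s_def by real_asymp
  then have "(\<lambda>k. s k *\<^sub>R w) \<longlonglongrightarrow> t *\<^sub>R w" by (intro tendsto_intros)
  then have "(\<lambda>k. kernel_mean a (s k *\<^sub>R w)) \<longlonglongrightarrow> kernel_mean a (t *\<^sub>R w)"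
    by (rule tendsto_kernel_mean[OF a, where \<rho>="norm w"])
       (use s w in \<open>auto intro!: mult_left_le_one_le less_imp_le[OF s(1)] less_imp_le[OF s(2)] simp: abs_of_pos\<close>)
  moreover have "kernel_mean a (s k *\<^sub>R w) \<le> Hp_pnorm p (\<lambda>z. kern w z ^ l)" for k
    unfolding Hp_pnorm_kern[OF a_def] using s by (intro SUP_upper) auto
  ultimately have "kernel_mean a (t *\<^sub>R w) \<le> Hp_pnorm p (\<lambda>z. kern w z ^ l)"
    by (intro LIMSEQ_le_const2) auto
  moreover have "kernel_mean a (t *\<^sub>R w) = kernel_mean a z"
    using False t by (intro kernel_mean_cong_norm) (simp add: t_def)
  ultimately show ?thesis by (simp add: a_def)
next
  case True
  then have "z = 0" using w by simp
  then have "kernel_mean (real CARD('n) * real l * p) z = kernel_mean (real CARD('n) * real l * p) ((1/2) *\<^sub>R w)" using True by simp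
  also have "\<dots> \<le> Hp_pnorm p (\<lambda>z. kern w z ^ l)"
    unfolding Hp_pnorm_kern[OF refl] by (intro SUP_upper) auto
  finally show ?thesis .
qed

lemma Hp_pnorm_kern_finite:
  fixes w :: "complex^'n"
  assumes w: "norm w < 1"
  shows "Hp_pnorm p (\<lambda>z. kern w z ^ l) < top"
proof -
  define a where "a = real CARD('n) * real l * p"
  have a: "0 \<le> a" using p by (simp add: a_def)
  have "Hp_pnorm p (\<lambda>z. kern w z ^ l) \<le> ennreal ((1 - norm w) powr - a)"
    unfolding Hp_pnorm_kern[OF a_def]
  proof (rule SUP_least)
    fix r :: real assume r: "r \<in> {0<..<1}"
    have rw: "norm (r *\<^sub>R w) \<le> norm w" using r by (simp add: mult_left_le_one_le)
    have "kernel_mean a (r *\<^sub>R w) \<le> ennreal ((1 - norm (r *\<^sub>R w)) powr - a)"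
      using rw w by (intro kernel_mean_le[OF a]) linarith
    also have "\<dots> \<le> ennreal ((1 - norm w) powr - a)"
      using rw w a by (intro ennreal_leI powr_mono2') linarith+
    finally show "kernel_mean a (r *\<^sub>R w) \<le> ennreal ((1 - norm w) powr - a)" .
  qed
  then show ?thesis by (simp add: le_less_trans)
qed

lemma Hp_pnorm_kern_pos:
  fixes w :: "complex^'n"
  assumes w: "norm w < 1"
  shows "0 < Hp_pnorm p (\<lambda>z. kern w z ^ l)"
proof -
  have "1 = kernel_mean (real CARD('n) * real l * p) (0 :: complex^'n)" by (simp add: kernel_mean_def cinner_def)
  also have "\<dots> \<le> Hp_pnorm p (\<lambda>z. kern w z ^ l)" by (rule kernel_mean_le_Hp_pnorm_kern[OF _ w]) simp
  finally show ?thesis using zero_less_one less_le_trans by blast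
qed

text \<open>With \<zeta> = \<open>sgn w\<close>, \<delta> = 1 - |w|^2 and
  \<open>v = (norm w)\<^sup>2 *\<^sub>R \<zeta>\<close>, the modulus
  \<open>cmod (1 - cinner \<xi> v)\<close> is at most 2 \<delta> on
  \<open>nball \<zeta> \<delta>\<close>, a set of measure at least a constant times \<delta>^n (n
  the complex dimension). The mean at \<open>v\<close> is one that the Hardy norm dominates. For
  \<open>p * l > 1\<close> the exponent of \<delta> is negative, whence the blow-up near the
  sphere.\<close>

lemma Hp_pnorm_kern_ge:
  obtains c where "0 < c" "\<And>w :: complex^'n. \<lbrakk>w \<noteq> 0; norm w < 1\<rbrakk> \<Longrightarrow>
    ennreal (c * 2 powr - (real CARD('n) * real l * p) * (1 - (norm w)\<^sup>2) powr (real CARD('n) - real CARD('n) * real l * p))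
      \<le> Hp_pnorm p (\<lambda>z. kern w z ^ l)"
proof -
  obtain c where c: "0 < c" "\<And>(\<zeta> :: complex^'n) \<delta>. \<lbrakk>norm \<zeta> = 1; 0 < \<delta>; \<delta> \<le> 1\<rbrakk> \<Longrightarrow> 
       emeasure sigma_sphere (nball \<zeta> \<delta>) \<ge> ennreal (c * \<delta> ^ CARD('n))"
    using emeasure_nball_ge[where 'n='n] by blast
  show thesis
  proof (rule that[OF c(1)])
    fix w :: "complex^'n" assume w: "w \<noteq> 0" "norm w < 1"
    define a where "a = real CARD('n) * real l * p"
    have a: "0 \<le> a" using p by (simp add: a_def)
    define \<zeta> where "\<zeta> = sgn w"
    have \<zeta>: "norm \<zeta> = 1" using w by (simp add: \<zeta>_def norm_sgn)
    define \<delta> where "\<delta> = 1 - (norm w)\<^sup>2"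
    have nw: "(norm w)\<^sup>2 < 1" using w by (simp add: power_less_one_iff abs_square_less_1)
    have \<delta>: "0 < \<delta>" "\<delta> \<le> 1" using nw by (auto simp: \<delta>_def)
    define v where "v = (norm w)\<^sup>2 *\<^sub>R \<zeta>"
    have nv: "norm v = (norm w)\<^sup>2" by (simp add: v_def \<zeta>)
    have bd: "ennreal ((2 * \<delta>) powr - a) * indicator (nball \<zeta> \<delta>) \<xi> \<le> ennreal (cmod (1 - cinner \<xi> v) powr - a)" for \<xi>
    proof (cases "\<xi> \<in> nball \<zeta> \<delta>")
      case True
      then have \<xi>: "norm \<xi> = 1" "cmod (1 - cinner \<xi> \<zeta>) \<le> \<delta>" using nball_commute by auto
      have "1 - cinner \<xi> v = (1 - cinner \<xi> \<zeta>) + of_real \<delta> * cinner \<xi> \<zeta>"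
        by (simp add: v_def \<delta>_def cinner_scaleR_right algebra_simps)
      then have "cmod (1 - cinner \<xi> v) \<le> cmod (1 - cinner \<xi> \<zeta>) + cmod (of_real \<delta> * cinner \<xi> \<zeta>)"
        by (simp only: norm_triangle_ineq)
      also have "\<dots> \<le> \<delta> + \<delta> * 1"
        using \<xi> \<delta> \<zeta> norm_cinner_le[of \<xi> \<zeta>] by (simp only: norm_mult norm_of_real abs_of_pos) (intro add_mono mult_left_mono, auto)
      finally have "cmod (1 - cinner \<xi> v) \<le> 2 * \<delta>" by simp
      \<comment> \<open>Positivity matters: \<open>0 powr - a\<close> is 0, which would break
        monotonicity.\<close>
      moreover have "0 < cmod (1 - cinner \<xi> v)"
        using norm_one_minus_cinner_ge[of \<xi> v] nw unfolding \<xi>(1) nv by linarith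
      ultimately show ?thesis using a True by (auto intro!: ennreal_leI powr_mono2')
    qed simp
    have "(2 * \<delta>) powr - a * \<delta> ^ CARD('n) = 2 powr - a * \<delta> powr (real CARD('n) - a)"
      using \<delta> by (simp add: powr_mult powr_diff powr_realpow powr_minus divide_inverse mult_ac)
    then have "ennreal (c * 2 powr - a * \<delta> powr (real CARD('n) - a)) = ennreal ((2 * \<delta>) powr - a) * ennreal (c * \<delta> ^ CARD('n))"
      using c(1) \<delta> by (simp add: mult_ac flip: ennreal_mult)
    also have "\<dots> \<le> ennreal ((2 * \<delta>) powr - a) * emeasure sigma_sphere (nball \<zeta> \<delta>)"
      by (intro mult_left_mono c(2) \<zeta> \<delta>) simp
    also have "\<dots> = (\<integral>\<^sup>+\<xi>. ennreal ((2 * \<delta>) powr - a) * indicator (nball \<zeta> \<delta>) \<xi> \<partial>sigma_sphere)"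
      by (simp add: nn_integral_cmult_indicator)
    also have "\<dots> \<le> kernel_mean a v" unfolding kernel_mean_def by (rule nn_integral_mono) (rule bd)
    also have "\<dots> \<le> Hp_pnorm p (\<lambda>z. kern w z ^ l)"
      unfolding a_def using w nv by (intro kernel_mean_le_Hp_pnorm_kern) (auto simp: power2_eq_square mult_left_le_one_le)
    finally show "ennreal (c * 2 powr - (real CARD('n) * real l * p) * (1 - (norm w)\<^sup>2) powr (real CARD('n) - real CARD('n) * real l * p))
      \<le> Hp_pnorm p (\<lambda>z. kern w z ^ l)" by (simp add: a_def \<delta>_def)
  qed
qed

lemma Kn_powr:
  fixes w z :: "complex^'n"
  assumes w: "norm w < 1"
  shows "cmod (Kn p l w z) powr p
    = cmod (1 - cinner z w) powr - (real CARD('n) * real l * p) / enn2real (Hp_pnorm p (\<lambda>z. kern w z ^ l))"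
proof -
  have "0 < enn2real (Hp_pnorm p (\<lambda>z. kern w z ^ l))"
    using Hp_pnorm_kern_pos[OF assms] Hp_pnorm_kern_finite[OF assms] by (simp add: enn2real_positive_iff)
  then show ?thesis
    using p by (simp add: Kn_def norm_divide powr_divide kern_powr[OF l] Hp_norm_def powr_powr)
qed

text \<open>The average \<open>H k\<close> of the normalised kernels over parameters in
  \<open>Q\<close>, pushed towards the sphere, is at most 1 on the closed ball and tends to 0 off
  \<open>Q\<close>. Hence its \<mu>-integral is bounded in the limit by the measure of
  \<open>Q\<close>, while (ii) keeps it above \<open>C\<close> times the \<sigma>-measure of
  \<open>Q\<close>.\<close>

lemma nball_le_of_Kn:
  fixes \<mu> :: "(complex^'n) measure"
  assumes pl: "1 < p * real l" and sets [measurable_cong]: "sets \<mu> = sets borel" and fin: "finite_measure \<mu>"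
    and Kn: "\<And>w. w \<in> ball 0 1 \<Longrightarrow> C \<le> (\<integral>\<^sup>+ z\<in>cball 0 1. ennreal (cmod (Kn p l w z) powr p) \<partial>\<mu>)"
  shows "C * emeasure sigma_sphere (nball \<zeta>\<^sub>0 \<delta>) \<le> emeasure \<mu> (nball \<zeta>\<^sub>0 \<delta>)"
proof -
  interpret \<mu>: finite_measure \<mu> by fact
  interpret pair_sigma_finite \<mu> "sigma_sphere :: (complex^'n) measure" by unfold_locales
  have [measurable]: "cball (0 :: complex^'n) 1 \<in> sets borel" by (simp add: borel_closed)
  define Q where "Q = nball \<zeta>\<^sub>0 \<delta>"
  have [measurable]: "Q \<in> sets borel" and closed_Q: "closed Q"
    by (simp_all add: Q_def nball_sets closed_nball)
  have Q1: "norm \<zeta> = 1" if "\<zeta> \<in> Q" for \<zeta> using that by (simp add: Q_def nball_def)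
  define a where "a = real CARD('n) * real l * p"
  have a: "0 < a" "real CARD('n) < a"
    using p l pl mult_strict_left_mono[OF pl, of "real CARD('n)"] by (simp_all add: a_def mult_ac)
  obtain i :: 'n where True by simp
  define e :: "complex^'n" where "e = axis i 1"
  have e: "norm e = 1" by (simp add: e_def)
  define r where "r k = 1 - 1 / real (k + 2)" for k
  have r: "0 < r k" "r k < 1" for k by (auto simp: r_def)
  \<comment> \<open>The normalising factor depends only on the norm of the parameter, so one
    reference point \<open>e\<close> serves for all \<zeta>.\<close>
  define N where "N k = enn2real (Hp_pnorm p (\<lambda>z. kern (r k *\<^sub>R e) z ^ l))" for k
  have Hp_N: "Hp_pnorm p (\<lambda>z. kern (r k *\<^sub>R e) z ^ l) = ennreal (N k)" for k
    unfolding N_def using Hp_pnorm_kern_finite[of "r k *\<^sub>R e"] r[of k] e by simp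
  have N: "0 < N k" for k
    using Hp_pnorm_kern_pos[of "r k *\<^sub>R e"] r[of k] e unfolding Hp_N by simp
  have N_top: "filterlim N at_top sequentially"
  proof -
    obtain c where c: "0 < c" "\<And>w :: complex^'n. \<lbrakk>w \<noteq> 0; norm w < 1\<rbrakk> \<Longrightarrow>
        ennreal (c * 2 powr - a * (1 - (norm w)\<^sup>2) powr (real CARD('n) - a)) \<le> Hp_pnorm p (\<lambda>z. kern w z ^ l)"
      using Hp_pnorm_kern_ge[where 'n='n] unfolding a_def by blast
    have ge: "c * 2 powr - a * (1 - (r k)\<^sup>2) powr (real CARD('n) - a) \<le> N k" for k
    proof -
      have "e \<noteq> 0" using e by auto
      then show ?thesis
        using c(2)[of "r k *\<^sub>R e"] e r[of k] N[of k] unfolding Hp_N by (auto simp: ennreal_le_iff)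
    qed
    define b where "b = a - real CARD('n)"
    have "0 < b" "0 < c * 2 powr - a" using a c(1) by (auto simp: b_def)
    then have "filterlim (\<lambda>k. c * 2 powr - a * (1 - (1 - 1 / real (k + 2))\<^sup>2) powr - b) at_top sequentially"
      by real_asymp
    then show ?thesis
      by (rule filterlim_at_top_mono) (use ge in \<open>auto simp: b_def r_def\<close>)
  qed
  define h where "h k \<zeta> z = ennreal (cmod (1 - cinner z (r k *\<^sub>R \<zeta>)) powr - a / N k)" for k and \<zeta> z :: "complex^'n"
  have Kn_h: "ennreal (cmod (Kn p l (r k *\<^sub>R \<zeta>) z) powr p) = h k \<zeta> z" if "norm \<zeta> = 1" for k and \<zeta> z :: "complex^'n"
    using that r[of k] e Hp_pnorm_kern_cong_norm[of "r k *\<^sub>R \<zeta>" "r k *\<^sub>R e"]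
    by (subst Kn_powr) (auto simp: h_def N_def a_def)
  define H where "H k z = (\<integral>\<^sup>+\<zeta>. h k \<zeta> z * indicator Q \<zeta> \<partial>sigma_sphere)" for k z
  have [measurable]: "(\<lambda>x. h k (f x) (g x)) \<in> borel_measurable M"
    if [measurable]: "f \<in> borel_measurable M" "g \<in> borel_measurable M" for k f g and M :: "'c measure"
    unfolding h_def by measurable
  have [measurable]: "H k \<in> borel_measurable borel" for k
    unfolding H_def by measurable
  have le_H: "C * emeasure sigma_sphere Q \<le> (\<integral>\<^sup>+z. H k z * indicator (cball 0 1) z \<partial>\<mu>)" for k
  proof -
    have "C * emeasure sigma_sphere Q = (\<integral>\<^sup>+\<zeta>. C * indicator Q \<zeta> \<partial>sigma_sphere)"
      by (simp add: nn_integral_cmult_indicator)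
    also have "\<dots> \<le> (\<integral>\<^sup>+\<zeta>. (\<integral>\<^sup>+z. h k \<zeta> z * indicator (cball 0 1) z \<partial>\<mu>) * indicator Q \<zeta> \<partial>sigma_sphere)"
    proof (rule nn_integral_mono)
      fix \<zeta>
      show "C * indicator Q \<zeta> \<le> (\<integral>\<^sup>+z. h k \<zeta> z * indicator (cball 0 1) z \<partial>\<mu>) * indicator Q \<zeta>"
        using Kn[of "r k *\<^sub>R \<zeta>"] Q1[of \<zeta>] r[of k] by (auto simp: indicator_def Kn_h)
    qed
    also have "\<dots> = (\<integral>\<^sup>+\<zeta>. (\<integral>\<^sup>+z. h k \<zeta> z * indicator (cball 0 1) z * indicator Q \<zeta> \<partial>\<mu>) \<partial>sigma_sphere)"
      by (simp add: nn_integral_multc)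
    also have "\<dots> = (\<integral>\<^sup>+z. (\<integral>\<^sup>+\<zeta>. h k \<zeta> z * indicator (cball 0 1) z * indicator Q \<zeta> \<partial>sigma_sphere) \<partial>\<mu>)"
      by (rule Fubini') measurable
    also have "\<dots> = (\<integral>\<^sup>+z. H k z * indicator (cball 0 1) z \<partial>\<mu>)"
      unfolding H_def by (subst nn_integral_multc[symmetric]) (auto simp: mult_ac intro!: nn_integral_cong)
    finally show ?thesis .
  qed
  \<comment> \<open>Moving the dilation from the parameter to \<open>z\<close> turns the integral
    over parameters into a kernel mean at \<open>r k *\<^sub>R z\<close>, whose norm is at most
    \<open>r k\<close>; the normalising factor dominates it.\<close>
  have H1: "H k z \<le> 1" if z: "norm z \<le> 1" for k z
  proof -
    have h_eq: "h k \<zeta> z = ennreal (cmod (1 - cinner \<zeta> (r k *\<^sub>R z)) powr - a) * ennreal (1 / N k)" for \<zeta>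
      using norm_one_minus_cinner_commute[of z "r k *\<^sub>R \<zeta>"] N[of k]
      by (simp add: h_def cinner_scaleR_left cinner_scaleR_right flip: ennreal_mult)
    have "H k z \<le> (\<integral>\<^sup>+\<zeta>. h k \<zeta> z \<partial>sigma_sphere)"
      unfolding H_def by (intro nn_integral_mono) (auto simp: indicator_def)
    also have "\<dots> = kernel_mean a (r k *\<^sub>R z) * ennreal (1 / N k)"
      unfolding h_eq kernel_mean_def by (rule nn_integral_multc) measurable
    also have "\<dots> \<le> ennreal (N k) * ennreal (1 / N k)"
      unfolding Hp_N[symmetric] a_def using z r[of k] e
      by (intro mult_right_mono kernel_mean_le_Hp_pnorm_kern) (auto simp: mult_left_le)
    also have "\<dots> = 1" using N[of k] by (simp flip: ennreal_mult)
    finally show ?thesis .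
  qed
  \<comment> \<open>As \<open>Q\<close> is closed, \<open>z\<close> has a distance \<open>d\<close>
    from it. Once the shift 1/(k+2) is below d/2, the dilated parameters stay at distance d/2, so
    the unnormalised kernels are bounded by the fixed \<open>B\<close> while \<open>N k\<close>
    tends to infinity.\<close>
  have H0: "(\<lambda>k. H k z) \<longlonglongrightarrow> 0" if z: "norm z \<le> 1" "z \<notin> Q" for z
  proof -
    obtain d where d: "0 < d" "\<And>\<zeta>. \<zeta> \<in> Q \<Longrightarrow> d \<le> dist z \<zeta>"
      using separate_point_closed[OF closed_Q z(2)] by blast
    define B where "B = (d\<^sup>2 / 8) powr - a"
    have "eventually (\<lambda>k. 1 / real (k + 2) < d / 2) sequentially" using d(1) by real_asymp
    then have "eventually (\<lambda>k. H k z \<le> ennreal (B / N k)) sequentially"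
    proof eventually_elim
      case (elim k)
      have "h k \<zeta> z \<le> ennreal (B / N k)" if \<zeta>: "\<zeta> \<in> Q" for \<zeta>
      proof -
        have "dist z \<zeta> \<le> dist z (r k *\<^sub>R \<zeta>) + dist (r k *\<^sub>R \<zeta>) \<zeta>" by (rule dist_triangle)
        also have "dist (r k *\<^sub>R \<zeta>) \<zeta> = norm ((r k - 1) *\<^sub>R \<zeta>)" by (simp add: dist_norm scaleR_diff_left)
        also have "\<dots> = 1 / real (k + 2)" using Q1[OF \<zeta>] by (simp add: r_def)
        finally have "d / 2 \<le> dist z (r k *\<^sub>R \<zeta>)" using d(2)[OF \<zeta>] elim by simp
        then have "(d / 2)\<^sup>2 \<le> (dist z (r k *\<^sub>R \<zeta>))\<^sup>2" using d(1) by (intro power_mono) auto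
        also have "\<dots> \<le> 2 * cmod (1 - cinner z (r k *\<^sub>R \<zeta>))"
          using z(1) Q1[OF \<zeta>] r[of k] by (intro dist_square_le_cinner) auto
        finally have "d\<^sup>2 / 8 \<le> cmod (1 - cinner z (r k *\<^sub>R \<zeta>))" by (simp add: power_divide)
        then have "cmod (1 - cinner z (r k *\<^sub>R \<zeta>)) powr - a \<le> B"
          unfolding B_def using d(1) a by (intro powr_mono2') auto
        then show ?thesis unfolding h_def using N[of k] by (intro ennreal_leI divide_right_mono) auto
      qed
      then have "H k z \<le> (\<integral>\<^sup>+\<zeta>. ennreal (B / N k) \<partial>(sigma_sphere :: (complex^'n) measure))"
        unfolding H_def by (intro nn_integral_mono) (auto simp: indicator_def)
      then show ?case by simp
    qed
    moreover have "(\<lambda>k. ennreal (B / N k)) \<longlonglongrightarrow> ennreal 0"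
      by (intro tendsto_ennrealI tendsto_divide_0[OF tendsto_const] filterlim_at_top_imp_at_infinity N_top)
    ultimately show ?thesis
      using tendsto_sandwich[of "\<lambda>_. 0" "\<lambda>k. H k z" sequentially "\<lambda>k. ennreal (B / N k)" 0] by simp
  qed
  \<comment> \<open>The constant 1 dominates and is integrable because \<mu> is finite.\<close>
  have "(\<lambda>k. \<integral>\<^sup>+z. H k z * indicator (cball 0 1 - Q) z \<partial>\<mu>) \<longlonglongrightarrow> (\<integral>\<^sup>+z. 0 \<partial>\<mu>)"
  proof (rule nn_integral_dominated_convergence[where w="\<lambda>_. 1"])
    show "AE z in \<mu>. H k z * indicator (cball 0 1 - Q) z \<le> 1" for k
      using H1 by (intro AE_I2) (auto simp: indicator_def)
    show "AE z in \<mu>. (\<lambda>k. H k z * indicator (cball 0 1 - Q) z) \<longlonglongrightarrow> 0"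
      using H0 by (intro AE_I2) (auto simp: indicator_def)
    show "(\<integral>\<^sup>+z. 1 \<partial>\<mu>) < \<infinity>" using \<mu>.emeasure_finite[of "space \<mu>"] by (simp add: less_top[symmetric])
  qed measurable
  then have "(\<lambda>k. emeasure \<mu> Q + (\<integral>\<^sup>+z. H k z * indicator (cball 0 1 - Q) z \<partial>\<mu>)) \<longlonglongrightarrow> emeasure \<mu> Q + 0"
    by (intro tendsto_add tendsto_const) simp
  moreover have "C * emeasure sigma_sphere Q \<le> emeasure \<mu> Q + (\<integral>\<^sup>+z. H k z * indicator (cball 0 1 - Q) z \<partial>\<mu>)" for k
  proof -
    have "C * emeasure sigma_sphere Q \<le> (\<integral>\<^sup>+z. H k z * indicator (cball 0 1) z \<partial>\<mu>)" by (rule le_H)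
    also have "\<dots> \<le> (\<integral>\<^sup>+z. indicator Q z + H k z * indicator (cball 0 1 - Q) z \<partial>\<mu>)"
      using H1[of _ k] Q1 by (intro nn_integral_mono) (auto simp: indicator_def)
    also have "\<dots> = emeasure \<mu> Q + (\<integral>\<^sup>+z. H k z * indicator (cball 0 1 - Q) z \<partial>\<mu>)"
      by (subst nn_integral_add) (auto simp: sets)
    finally show ?thesis .
  qed
  ultimately have "C * emeasure sigma_sphere Q \<le> emeasure \<mu> Q + 0"
    by (intro LIMSEQ_le_const) auto
  then show ?thesis by (simp add: Q_def)
qed

section \<open>The normalised kernels as test functions of Hardy norm 1\<close>

lemma holo_on_Kn:
  fixes w :: "complex^'n"
  assumes w: "norm w < 1"
  shows "holo_on (Kn p l w) (ball 0 1)"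
  unfolding holo_on_def
proof
  fix z :: "complex^'n" assume "z \<in> ball 0 1"
  \<comment> \<open>The kernel is a one-variable function, holomorphic off 1, composed with the
    complex-linear map \<open>\<lambda>z. cinner z w\<close>, which avoids 1 on the open
    ball.\<close>
  define F where "F x = inverse ((1 - x) ^ CARD('n)) ^ l / complex_of_real (Hp_norm p (\<lambda>z. kern w z ^ l))" for x
  have "norm z * norm w < 1" using \<open>z \<in> ball 0 1\<close> w mult_left_le_one_le[of "norm w" "norm z"] by simp
  then have "cinner z w \<noteq> 1" using norm_one_minus_cinner_ge[of z w] by auto
  moreover have "F holomorphic_on - {1}" unfolding F_def by (intro holomorphic_intros) auto
  ultimately have "(F has_field_derivative deriv F (cinner z w)) (at (cinner z w))"
    by (intro holomorphic_derivI[where S="- {1}"]) auto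
  then have F: "(F has_derivative (*) (deriv F (cinner z w))) (at (cinner z w))"
    by (simp add: has_field_derivative_def)
  have "bounded_linear (\<lambda>z. cinner z w)"
    by (rule bounded_linear_intro[where K="norm w"])
       (simp_all add: cinner_add_left cinner_scaleR_left scaleR_conv_of_real[where 'a=complex] norm_cinner_le)
  from has_derivative_compose[OF bounded_linear_imp_has_derivative[OF this, of "at z"] F]
  have "((\<lambda>z. F (cinner z w)) has_derivative (\<lambda>x. deriv F (cinner z w) * cinner x w)) (at z)" .
  moreover have "(\<lambda>z. F (cinner z w)) = Kn p l w" by (simp add: F_def Kn_def kern_def fun_eq_iff)
  ultimately show "\<exists>L. (Kn p l w has_derivative L) (at z) \<and> (\<forall>c x. L (c *s x) = c * L x)"
    by (auto intro!: exI[of _ "\<lambda>x. deriv F (cinner z w) * cinner x w"] simp: cinner_smult_left)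
qed

lemma continuous_on_Kn:
  fixes w :: "complex^'n"
  assumes w: "norm w < 1"
  shows "continuous_on (cball 0 1) (Kn p l w)"
proof -
  have "cinner z w \<noteq> 1" if "z \<in> cball 0 1" for z
  proof -
    have "norm z * norm w < 1" using that w mult_left_le_one_le[of "norm w" "norm z"] by simp
    then show ?thesis using norm_one_minus_cinner_ge[of z w] by auto
  qed
  moreover have "Hp_norm p (\<lambda>z. kern w z ^ l) \<noteq> 0"
    using Hp_pnorm_kern_pos[OF w] Hp_pnorm_kern_finite[OF w]
    by (auto simp: Hp_norm_def enn2real_eq_0_iff)
  ultimately show ?thesis
    unfolding Kn_def kern_def by (intro continuous_intros) auto
qed

lemma Hp_pnorm_Kn:
  fixes w :: "complex^'n"
  assumes w: "norm w < 1"
  shows "Hp_pnorm p (Kn p l w) = 1"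
proof -
  define N where "N = enn2real (Hp_pnorm p (\<lambda>z. kern w z ^ l))"
  have Hp_N: "Hp_pnorm p (\<lambda>z. kern w z ^ l) = ennreal N"
    unfolding N_def using Hp_pnorm_kern_finite[OF w] by simp
  have N: "0 < N" using Hp_pnorm_kern_pos[OF w] unfolding Hp_N by simp
  have "Hp_pnorm p (Kn p l w) = (SUP r\<in>{0<..<1}. ennreal (1 / N) * (\<integral>\<^sup>+ \<zeta>. ennreal (cmod (kern w (r *\<^sub>R \<zeta>) ^ l) powr p) \<partial>sigma_sphere))"
    unfolding Hp_pnorm_def
  proof (intro SUP_cong refl)
    fix r :: real
    have "ennreal (cmod (Kn p l w (r *\<^sub>R \<zeta>)) powr p) = ennreal (1 / N) * ennreal (cmod (kern w (r *\<^sub>R \<zeta>) ^ l) powr p)" for \<zeta>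
      using N by (simp add: Kn_powr[OF w] kern_powr[OF l] N_def flip: ennreal_mult)
    moreover have "(\<lambda>\<zeta>. ennreal (cmod (kern w (r *\<^sub>R \<zeta>) ^ l) powr p)) \<in> borel_measurable sigma_sphere"
      unfolding kern_def by measurable
    ultimately show "(\<integral>\<^sup>+ \<zeta>. ennreal (cmod (Kn p l w (r *\<^sub>R \<zeta>)) powr p) \<partial>sigma_sphere)
        = ennreal (1 / N) * (\<integral>\<^sup>+ \<zeta>. ennreal (cmod (kern w (r *\<^sub>R \<zeta>) ^ l) powr p) \<partial>sigma_sphere)"
      by (simp add: nn_integral_cmult)
  qed
  also have "\<dots> = ennreal (1 / N) * Hp_pnorm p (\<lambda>z. kern w z ^ l)"
    unfolding Hp_pnorm_def by (subst SUP_mult_left_ennreal) simp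
  also have "\<dots> = 1" unfolding Hp_N using N by (simp flip: ennreal_mult)
  finally show ?thesis .
qed

end

theorem theorem7p1:
  fixes p :: real and l :: nat and \<mu> :: "(complex^'n) measure"
  assumes "0 < p" and "0 < l" and "p * real l > 1"
    and "sets \<mu> = sets borel" and "finite_measure \<mu>"
    and "emeasure \<mu> (- cball 0 1) = 0"
  shows "((\<exists>C>0. \<forall>f. continuous_on (cball 0 1) f \<and> in_Hp p f \<longrightarrow>
              (\<integral>\<^sup>+ z\<in>cball 0 1. ennreal (cmod (f z) powr p) \<partial>\<mu>) \<ge> ennreal C * Hp_pnorm p f)
          \<longleftrightarrow> (\<exists>C>0. \<forall>w\<in>ball 0 1.
              (\<integral>\<^sup>+ z\<in>cball 0 1. ennreal (cmod (Kn p l w z) powr p) \<partial>\<mu>) \<ge> ennreal C))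
       \<and> ((\<exists>C>0. \<forall>w\<in>ball 0 1.
              (\<integral>\<^sup>+ z\<in>cball 0 1. ennreal (cmod (Kn p l w z) powr p) \<partial>\<mu>) \<ge> ennreal C)
          \<longleftrightarrow> (\<exists>C>0. \<forall>\<zeta>\<in>sphere 0 1. \<forall>\<delta>>0.
              emeasure \<mu> (nball \<zeta> \<delta>) \<ge> ennreal C * emeasure sigma_sphere (nball \<zeta> \<delta>)))"
proof -
  note K = \<open>0 < p\<close> \<open>0 < l\<close>
  let ?i = "\<lambda>C. \<forall>f. continuous_on (cball 0 1) f \<and> in_Hp p f \<longrightarrow>
    (\<integral>\<^sup>+ z\<in>cball 0 1. ennreal (cmod (f z) powr p) \<partial>\<mu>) \<ge> ennreal C * Hp_pnorm p f"
  let ?ii = "\<lambda>C. \<forall>w\<in>ball 0 1. (\<integral>\<^sup>+ z\<in>cball 0 1. ennreal (cmod (Kn p l w z) powr p) \<partial>\<mu>) \<ge> ennreal C"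
  let ?iii = "\<lambda>C. \<forall>\<zeta>\<in>sphere 0 1. \<forall>\<delta>>0. emeasure \<mu> (nball \<zeta> \<delta>) \<ge> ennreal C * emeasure sigma_sphere (nball \<zeta> \<delta>)"
  have i_ii: "?ii C" if "?i C" for C
  proof
    fix w :: "complex^'n" assume "w \<in> ball 0 1"
    then have w: "norm w < 1" by simp
    have "continuous_on (cball 0 1) (Kn p l w) \<and> in_Hp p (Kn p l w)"
      using continuous_on_Kn[OF K w] holo_on_Kn[OF K w] Hp_pnorm_Kn[OF K w] by (simp add: in_Hp_def)
    then have "ennreal C * Hp_pnorm p (Kn p l w) \<le> (\<integral>\<^sup>+ z\<in>cball 0 1. ennreal (cmod (Kn p l w z) powr p) \<partial>\<mu>)"
      using that by blast
    then show "ennreal C \<le> (\<integral>\<^sup>+ z\<in>cball 0 1. ennreal (cmod (Kn p l w z) powr p) \<partial>\<mu>)"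
      by (simp add: Hp_pnorm_Kn[OF K w])
  qed
  have ii_iii: "?iii C" if ii: "?ii C" for C
    by (intro ballI allI impI nball_le_of_Kn[OF K assms(3-5)] ii[rule_format])
  have iii_i: "?i C" if iii: "?iii C" for C
  proof (intro allI impI)
    fix f :: "complex^'n \<Rightarrow> complex" assume "continuous_on (cball 0 1) f \<and> in_Hp p f"
    then have f: "continuous_on (cball 0 1) f" "holo_on f (ball 0 1)" by (auto simp: in_Hp_def)
    have "continuous_on (sphere 0 1) (\<lambda>z. cmod (f z) powr p)"
      using K by (intro continuous_on_powr' continuous_intros continuous_on_subset[OF f(1)]) auto
    note avg = nn_integral_sphere_le_of_nball[OF assms(4,5) _ this]
    have "ennreal C * Hp_pnorm p f \<le> ennreal C * (\<integral>\<^sup>+\<zeta>\<in>sphere 0 1. ennreal (cmod (f \<zeta>) powr p) \<partial>sigma_sphere)"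
      by (intro mult_left_mono Hp_pnorm_le_boundary K f) simp
    also have "\<dots> \<le> (\<integral>\<^sup>+z\<in>sphere 0 1. ennreal (cmod (f z) powr p) \<partial>\<mu>)"
      using iii by (intro avg) auto
    also have "\<dots> \<le> (\<integral>\<^sup>+z\<in>cball 0 1. ennreal (cmod (f z) powr p) \<partial>\<mu>)"
      by (intro nn_integral_mono) (auto simp: indicator_def)
    finally show "ennreal C * Hp_pnorm p f \<le> (\<integral>\<^sup>+z\<in>cball 0 1. ennreal (cmod (f z) powr p) \<partial>\<mu>)" .
  qed
  \<comment> \<open>The implications form a cycle, and each preserves the constant
    \<open>C\<close>.\<close>
  have "((\<exists>C>0. P C) \<longleftrightarrow> (\<exists>C>0. Q C)) \<and> ((\<exists>C>0. Q C) \<longleftrightarrow> (\<exists>C>0. R C))"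
    if "\<And>C. P C \<Longrightarrow> Q C" "\<And>C. Q C \<Longrightarrow> R C" "\<And>C. R C \<Longrightarrow> P C" for P Q R :: "real \<Rightarrow> bool"
    using that by blast
  from this[of ?i ?ii ?iii, OF i_ii ii_iii iii_i] show ?thesis .
qed

end
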